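(* Consider the symmetric Cartan matrices $$A=\begin{pmatrix}2&-1&0&0&-1&0\\-1&2&-1&0&0&0\\0&-1&2&-1&0&0\\0&0&-1&2&-1&0\\-1&0&0&-1&2&-1\\0&0&0&0&-1&2\end{pmatrix},\qquad B=\begin{pmatrix}2&-1&0&0&0&0\\-1&2&-1&0&-1&-1\\0&-1&2&-1&0&0\\0&0&-1&2&0&0\\0&-1&0&0&2&0\\0&-1&0&0&0&2\end{pmatrix}.$$ Their Poincaré series are $$P(A)=\frac{(1-t^2)(1-t^5)(1-t^6)(1-t^8)}{(1-t)^4(t^{16}-t^{15}-t^{11}+t^9-t^8+t^7+t^3-2t+1)},$$ $$P(B)=\frac{(1-t^2)^2(1-t^4)(1-t^6)(1-t^8)}{(1-t)^5(t^{16}-t^{14}-t^{12}+t^8-t^7+2t^5+t^4-t^3-t^2-t+1)}.$$ For $M\in\{A,B\}$ put $C_M(t)=P(M)(1-t)^6(1-t^2)^{-1}$ and $B_M(t)=1-C_M(t)^{-1}$. Then, as power series, $$B_A(t)=t^2+t^3+t^4+t^7+t^8+t^9-t^{15}-2t^{16}-2t^{17}-3t^{18}-3t^{19}+O(t^{20}),$$ $$B_B(t)=2t^3+t^5-t^6+3t^7-2t^8+3t^9-2t^{10}+5t^{11}-4t^{12}+4t^{13}-5t^{14}+8t^{15}-8t^{16}+6t^{17}-10t^{18}+10t^{19}+O(t^{20}).$$ In particular $B_A(t)$ and $B_B(t)$ have negative coefficients, so $A$ and $B$ are counterexamples to Kac's conjecture that, for every Kac-Moody Lie algebra of indefinite type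 with $n\times n$ Cartan matrix $M$, the series $C(t)=P(M)(1-t)^n(1-t^2)^{-\epsilon}$ has the form $C(t)=\frac{1}{1-B(t)}$ with $B(t)=b_2t^2+b_3t^3+\cdots$ and all $b_i\ge 0$.
   Context: A Cartan matrix is an $n\times n$ integer matrix $M=(a_{ij})$ with $a_{ii}=2$ for all $i$, $a_{ij}\le 0$ for $i\ne j$, and $a_{ij}=0\Rightarrow a_{ji}=0$. Its Weyl group is the Coxeter group $W(M)=\langle \sigma_1,\dots,\sigma_n \mid \sigma_i^2=1,\ (\sigma_i\sigma_j)^{m_{ij}}=1\ (i\ne j)\rangle$, where for $i\neq j$ one puts $m_{ij}=2,3,4,6,\infty$ according as $a_{ij}a_{ji}=0,1,2,3,\ge 4$ respectively. Let $l(w)$ be the length of $w\in W(M)$ with respect to the generators. The Poincaré series is $P(M)=\sum_{w\in W(M)}t^{l(w)}$. $M$ is symmetrizable if $M=DS$ with $D$ an invertible diagonal matrix and $S$ a symmetric matrix; $\epsilon=1$ if $M$ is symmetrizable and $\epsilon=0$ otherwise (so $\epsilon=1$ for symmetric $M$). $M$ is of finite type if it is (after symmetrization) positive definite, of affine type if it is positive semi-definite of rank $n-1$, and of indefinite type otherwise. *)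

theory Defs
  imports
    "HOL-Algebra.Group"
    "HOL-Library.Extended_Nat"
    "HOL-Computational_Algebra.Formal_Power_Series"
    "Jordan_Normal_Form.DL_Rank"
begin

text \<open>A letter \<open>(s, True)\<close> stands for the generator \<open>s\<close>, and \<open>(s, False)\<close> for its formal inverse.
  The group \<open>\<langle>S | R\<rangle>\<close> consists of the words in the letters over \<open>S\<close> modulo the smallest congruence
  that cancels adjacent inverse letters and identifies every relator in \<open>R\<close> with the empty word.\<close>

type_synonym 'a group_word = "('a \<times> bool) list"

abbreviation group_words :: "'a set \<Rightarrow> 'a group_word set" where
  "group_words S \<equiv> lists (S \<times> UNIV)"

inductive_set pres_rel ::
  "'a set \<Rightarrow> 'a group_word set \<Rightarrow> ('a group_word \<times> 'a group_word) set"
  for S :: "'a set" and R :: "'a group_word set" where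
  pres_refl: "u \<in> group_words S \<Longrightarrow> (u, u) \<in> pres_rel S R"
| pres_sym: "(u, v) \<in> pres_rel S R \<Longrightarrow> (v, u) \<in> pres_rel S R"
| pres_trans: "(u, v) \<in> pres_rel S R \<Longrightarrow> (v, w) \<in> pres_rel S R \<Longrightarrow> (u, w) \<in> pres_rel S R"
| pres_append: "(u, u') \<in> pres_rel S R \<Longrightarrow> (v, v') \<in> pres_rel S R \<Longrightarrow> (u @ v, u' @ v') \<in> pres_rel S R"
| pres_cancel: "s \<in> S \<Longrightarrow> ([(s, b), (s, \<not> b)], []) \<in> pres_rel S R"
| pres_relator: "r \<in> R \<Longrightarrow> r \<in> group_words S \<Longrightarrow> (r, []) \<in> pres_rel S R"

definition presented_group :: "'a set \<Rightarrow> 'a group_word set \<Rightarrow> 'a group_word set monoid" where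
  "presented_group S R =
     \<lparr>carrier = group_words S // pres_rel S R,
      mult = (\<lambda>X Y. \<Union>x\<in>X. \<Union>y\<in>Y. pres_rel S R `` {x @ y}),
      one = pres_rel S R `` {[]}\<rparr>"

lemma pres_rel_words:
  "(u, v) \<in> pres_rel S R \<Longrightarrow> u \<in> group_words S \<and> v \<in> group_words S"
  by (induction rule: pres_rel.induct) auto

lemma equiv_pres_rel: "equiv (group_words S) (pres_rel S R)"
proof (rule equivI)
  show "pres_rel S R \<subseteq> group_words S \<times> group_words S"
    by (rule subrelI) (simp only: mem_Sigma_iff pres_rel_words simp_thms)
  show "refl_on (group_words S) (pres_rel S R)"
    by (auto intro!: refl_onI pres_rel.pres_refl)
  show "sym (pres_rel S R)"
    by (auto intro!: symI pres_rel.pres_sym)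
  show "trans (pres_rel S R)"
    by (rule transI) (rule pres_rel.pres_trans)
qed

lemma presented_group_mult:
  assumes "u \<in> group_words S" "v \<in> group_words S"
  shows "(pres_rel S R `` {u}) \<otimes>\<^bsub>presented_group S R\<^esub> (pres_rel S R `` {v}) = pres_rel S R `` {u @ v}"
proof -
  note E = equiv_pres_rel[of S R]
  have c: "pres_rel S R `` {x @ y} = pres_rel S R `` {u @ v}"
    if "(u, x) \<in> pres_rel S R" "(v, y) \<in> pres_rel S R" for x y
    using equiv_class_eq[OF E pres_append[OF that]] by simp
  have "(u, u) \<in> pres_rel S R" "(v, v) \<in> pres_rel S R"
    using assms by (auto intro: pres_refl)
  then have "(\<Union>x\<in>pres_rel S R `` {u}. \<Union>y\<in>pres_rel S R `` {v}. pres_rel S R `` {x @ y})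
      = pres_rel S R `` {u @ v}"
    using c by blast
  then show ?thesis
    by (simp only: presented_group_def monoid.simps)
qed

lemma group_presented_group: "group (presented_group S R)"
proof (rule groupI)
  let ?G = "presented_group S R" and ?r = "pres_rel S R"
  have car: "carrier ?G = group_words S // ?r" and one: "\<one>\<^bsub>?G\<^esub> = ?r `` {[]}"
    by (simp_all add: presented_group_def)
  note m = presented_group_mult
  show "\<one>\<^bsub>?G\<^esub> \<in> carrier ?G"
    unfolding car one by (rule quotientI) simp
  show "x \<otimes>\<^bsub>?G\<^esub> y \<in> carrier ?G" if "x \<in> carrier ?G" "y \<in> carrier ?G" for x y
  proof -
    from that obtain u v where uv: "u \<in> group_words S" "v \<in> group_words S"
      and "x = ?r `` {u}" "y = ?r `` {v}"
      unfolding car by (elim quotientE)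
    then have "x \<otimes>\<^bsub>?G\<^esub> y = ?r `` {u @ v}" by (simp only: m)
    moreover have "u @ v \<in> group_words S" using uv by simp
    ultimately show ?thesis unfolding car by (simp only: quotientI)
  qed
  show "x \<otimes>\<^bsub>?G\<^esub> y \<otimes>\<^bsub>?G\<^esub> z = x \<otimes>\<^bsub>?G\<^esub> (y \<otimes>\<^bsub>?G\<^esub> z)"
    if "x \<in> carrier ?G" "y \<in> carrier ?G" "z \<in> carrier ?G" for x y z
  proof -
    from that obtain u v w where uvw: "u \<in> group_words S" "v \<in> group_words S" "w \<in> group_words S"
      and xyz: "x = ?r `` {u}" "y = ?r `` {v}" "z = ?r `` {w}"
      unfolding car by (elim quotientE)
    have "u @ v \<in> group_words S" "v @ w \<in> group_words S" using uvw by simp_all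
    then show ?thesis unfolding xyz by (simp only: m uvw append_assoc)
  qed
  show "\<one>\<^bsub>?G\<^esub> \<otimes>\<^bsub>?G\<^esub> x = x" if "x \<in> carrier ?G" for x
  proof -
    from that obtain u where u: "u \<in> group_words S" and x: "x = ?r `` {u}"
      unfolding car by (elim quotientE)
    show ?thesis unfolding one x by (simp only: m u lists.Nil append_Nil)
  qed
  show "\<exists>y\<in>carrier ?G. y \<otimes>\<^bsub>?G\<^esub> x = \<one>\<^bsub>?G\<^esub>" if x: "x \<in> carrier ?G" for x
  proof -
    from x obtain u where u: "u \<in> group_words S" and xu: "x = ?r `` {u}"
      unfolding car by (elim quotientE)
    have "\<exists>v\<in>group_words S. (v @ u, []) \<in> ?r"
      using u
    proof (induction u rule: list.induct)
      case Nil
      then show ?case by (auto intro!: bexI[of _ "[]"] pres_refl)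
    next
      case (Cons a u)
      then obtain v where v: "v \<in> group_words S" "(v @ u, []) \<in> ?r" by auto
      obtain s b where a: "a = (s, b)" by (cases a)
      have s: "s \<in> S" and u: "u \<in> group_words S" using Cons.prems a by auto
      have "([(s, \<not> b), (s, b)], []) \<in> ?r" using pres_cancel[OF s, of "\<not> b"] by simp
      then have "([(s, \<not> b), (s, b)] @ u, [] @ u) \<in> ?r"
        by (rule pres_append) (rule pres_refl[OF u])
      then have "(v @ ([(s, \<not> b), (s, b)] @ u), v @ ([] @ u)) \<in> ?r"
        by (rule pres_append[OF pres_refl[OF v(1)]])
      then have "((v @ [(s, \<not> b)]) @ (a # u), []) \<in> ?r"
        using pres_trans[OF _ v(2)] by (simp add: a)
      moreover have "v @ [(s, \<not> b)] \<in> group_words S" using v s by auto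
      ultimately show ?case by blast
    qed
    then obtain v where v: "v \<in> group_words S" "(v @ u, []) \<in> ?r" by blast
    show ?thesis
    proof (rule bexI)
      show "?r `` {v} \<otimes>\<^bsub>?G\<^esub> x = \<one>\<^bsub>?G\<^esub>"
        using equiv_class_eq[OF equiv_pres_rel v(2)] by (simp only: xu one m v(1) u)
      show "?r `` {v} \<in> carrier ?G"
        unfolding car using v(1) by (rule quotientI)
    qed
  qed
qed

definition cartan_matrix :: "int mat \<Rightarrow> bool" where
  "cartan_matrix M \<longleftrightarrow> square_mat M \<and>
     (\<forall>i<dim_row M. M $$ (i, i) = 2) \<and>
     (\<forall>i<dim_row M. \<forall>j<dim_row M. i \<noteq> j \<longrightarrow> M $$ (i, j) \<le> 0) \<and>
     (\<forall>i<dim_row M. \<forall>j<dim_row M. M $$ (i, j) = 0 \<longrightarrow> M $$ (j, i) = 0)"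

definition symmetric_matrix :: "'a mat \<Rightarrow> bool" where
  "symmetric_matrix S \<longleftrightarrow> transpose_mat S = S"

definition symmetrization :: "int mat \<Rightarrow> real mat \<Rightarrow> bool" where
  "symmetrization M S \<longleftrightarrow>
     S \<in> carrier_mat (dim_row M) (dim_row M) \<and> symmetric_matrix S \<and>
     (\<exists>D \<in> carrier_mat (dim_row M) (dim_row M).
        diagonal_mat D \<and> invertible_mat D \<and> map_mat real_of_int M = D * S)"

definition symmetrizable :: "int mat \<Rightarrow> bool" where
  "symmetrizable M \<longleftrightarrow> (\<exists>S. symmetrization M S)"

definition pos_definite :: "real mat \<Rightarrow> bool" where
  "pos_definite S \<longleftrightarrow>
     (\<forall>v \<in> carrier_vec (dim_row S). v \<noteq> 0\<^sub>v (dim_row S) \<longrightarrow> v \<bullet> (S *\<^sub>v v) > 0)"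

definition pos_semidefinite :: "real mat \<Rightarrow> bool" where
  "pos_semidefinite S \<longleftrightarrow> (\<forall>v \<in> carrier_vec (dim_row S). v \<bullet> (S *\<^sub>v v) \<ge> 0)"

text \<open>The diagonal factor \<open>D\<close> of a symmetrization may have entries of either sign. Since the
  diagonal entries of \<open>M\<close> equal 2, a symmetrization that is positive semi-definite forces
  all entries of \<open>D\<close> to be positive, so the existential quantifiers below need no sign condition.
  The rank equation is stated with \<open>Suc\<close> to avoid truncated subtraction.\<close>

definition finite_type :: "int mat \<Rightarrow> bool" where
  "finite_type M \<longleftrightarrow> (\<exists>S. symmetrization M S \<and> pos_definite S)"

definition affine_type :: "int mat \<Rightarrow> bool" where
  "affine_type M \<longleftrightarrow>
     (\<exists>S. symmetrization M S \<and> pos_semidefinite S \<and> Suc (vec_space.rank (dim_row M) S) = dim_row M)"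

definition indefinite_type :: "int mat \<Rightarrow> bool" where
  "indefinite_type M \<longleftrightarrow> \<not> finite_type M \<and> \<not> affine_type M"

definition coxeter_exponent :: "int mat \<Rightarrow> nat \<Rightarrow> nat \<Rightarrow> enat" where
  "coxeter_exponent M i j =
     (let p = M $$ (i, j) * M $$ (j, i) in
      if p = 0 then 2 else if p = 1 then 3 else if p = 2 then 4 else if p = 3 then 6 else \<infinity>)"

text \<open>Generators are numbered from 0. An infinite exponent contributes no relator.\<close>

definition weyl_relators :: "int mat \<Rightarrow> nat group_word set" where
  "weyl_relators M =
     {[(i, True), (i, True)] | i. i < dim_row M} \<union>
     {concat (replicate m [(i, True), (j, True)]) | i j m.
        i < dim_row M \<and> j < dim_row M \<and> i \<noteq> j \<and> coxeter_exponent M i j = enat m}"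

definition weyl_group :: "int mat \<Rightarrow> nat group_word set monoid" where
  "weyl_group M = presented_group {..<dim_row M} (weyl_relators M)"

definition weyl_gen :: "int mat \<Rightarrow> nat \<Rightarrow> nat group_word set" where
  "weyl_gen M i = pres_rel {..<dim_row M} (weyl_relators M) `` {[(i, True)]}"

definition weyl_length :: "int mat \<Rightarrow> nat group_word set \<Rightarrow> nat" where
  "weyl_length M w = (LEAST k. \<exists>xs \<in> lists {..<dim_row M}. length xs = k \<and>
     w = foldr (\<lambda>i g. weyl_gen M i \<otimes>\<^bsub>weyl_group M\<^esub> g) xs \<one>\<^bsub>weyl_group M\<^esub>)"

text \<open>The coefficient of \<open>t ^ k\<close> in the sum of \<open>t ^ l(w)\<close> over all \<open>w\<close> is the number of elements of
  length \<open>k\<close>, which is finite because there are finitely many generators.\<close>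

definition poincare_series :: "int mat \<Rightarrow> rat fps" where
  "poincare_series M =
     Abs_fps (\<lambda>k. of_nat (card {w \<in> carrier (weyl_group M). weyl_length M w = k}))"

definition symm_eps :: "int mat \<Rightarrow> nat" where
  "symm_eps M = (if symmetrizable M then 1 else 0)"

definition kac_series :: "int mat \<Rightarrow> rat fps" where
  "kac_series M =
     poincare_series M * (1 - fps_X) ^ dim_row M * inverse ((1 - fps_X ^ 2) ^ symm_eps M)"

definition has_kac_form :: "int mat \<Rightarrow> bool" where
  "has_kac_form M \<longleftrightarrow>
     (\<exists>b. fps_nth b 0 = 0 \<and> fps_nth b 1 = 0 \<and> (\<forall>i\<ge>2. fps_nth b i \<ge> 0) \<and>
          kac_series M = 1 / (1 - b))"

definition kac_conjecture :: bool where
  "kac_conjecture \<longleftrightarrow> (\<forall>M. cartan_matrix M \<and> indefinite_type M \<longrightarrow> has_kac_form M)"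

definition kac_counterexample :: "int mat \<Rightarrow> bool" where
  "kac_counterexample M \<longleftrightarrow> cartan_matrix M \<and> indefinite_type M \<and> \<not> has_kac_form M"

definition cartan_A :: "int mat" where
  "cartan_A = mat_of_rows_list 6
     [[ 2, -1,  0,  0, -1,  0],
      [-1,  2, -1,  0,  0,  0],
      [ 0, -1,  2, -1,  0,  0],
      [ 0,  0, -1,  2, -1,  0],
      [-1,  0,  0, -1,  2, -1],
      [ 0,  0,  0,  0, -1,  2]]"

definition cartan_B :: "int mat" where
  "cartan_B = mat_of_rows_list 6
     [[ 2, -1,  0,  0,  0,  0],
      [-1,  2, -1,  0, -1, -1],
      [ 0, -1,  2, -1,  0,  0],
      [ 0,  0, -1,  2,  0,  0],
      [ 0, -1,  0,  0,  2,  0],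
      [ 0, -1,  0,  0,  0,  2]]"

end

theory Submission
  imports Defs
begin

text \<open>The Poincare series of a Coxeter group is determined by those of its proper parabolic subgroups
\<open>W\<^sub>I\<close>. Every element of \<open>W\<^sub>J\<close> factors uniquely, with additive lengths, into a minimal coset
representative and an element of \<open>W\<^sub>I\<close>, and the representatives are the elements without descents in \<open>I\<close>.
Inclusion and exclusion over the descent set therefore gives
\<open>(\<Sum>I \<subseteq> J. (-1) ^ card I * W\<^sub>J(t) / W\<^sub>I(t)) = t ^ N\<close> if \<open>W\<^sub>J\<close> is finite with longest element of length
\<open>N\<close>, and \<open>0\<close> if \<open>W\<^sub>J\<close> is infinite (\<open>inverse_series_recursion\<close>).

The group theory rests on the Tits representation. Since only the exponents 2 and 3 occur, a short
induction shows that \<open>w s\<close> is longer than \<open>w\<close> exactly if \<open>w\<close> maps the simple root of \<open>s\<close> to a positive root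
(\<open>wlen_trichotomy\<close>). It follows that the representation is faithful, so that the presented group can be
replaced by a group of functions (\<open>poincare_series_eq\<close>). Longest elements are found by playing the numbers
game on heights of roots (\<open>numbers_game_sound\<close>). Infinite subgroups are recognized by a positive vector that
pairs nonpositively with all simple roots, namely the null root of an affine subgraph
(\<open>full_descent_empty\<close>).

For the two matrices of rank 6, the recursion over all 64 subsets is solved in polynomial arithmetic on
coefficient lists, after multiplication by a common denominator. Only the final table is
checked against the recursion, which has a unique solution (\<open>certified_series\<close>). The expansions of the
series \<open>1 - 1 / C\<close> reduce to the vanishing of the first 20 coefficients of a polynomial
(\<open>kac_expansion\<close>); the coefficients at \<open>t ^ 15\<close> and \<open>t ^ 6\<close>, respectively, are negative. Both matrices are
of indefinite type, because the null root of the affine subgraph together with the root of the additional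
vertex yields a vector of negative norm.\<close>

section \<open>Simply laced Tits representations\<close>

definition simple_root :: "'i \<Rightarrow> 'i \<Rightarrow> int" where
  "simple_root i = (\<lambda>k. if k = i then 1 else 0)"

text \<open>The Coxeter groups in question have only the exponents 2 and 3. For these the Tits representation
is defined over the integers: the generator \<open>i\<close> acts on integer combinations of simple roots as
the reflection for the symmetric form with Gram matrix \<open>a\<close>. Vectors are functions on all
indices; their coordinates outside \<open>S\<close> are never changed.\<close>

locale simply_laced =
  fixes S :: "'i set" and a :: "'i \<Rightarrow> 'i \<Rightarrow> int"
  assumes finite_S: "finite S"
    and a_diag: "i \<in> S \<Longrightarrow> a i i = 2"
    and a_sym: "i \<in> S \<Longrightarrow> j \<in> S \<Longrightarrow> a i j = a j i"
    and a_off: "i \<in> S \<Longrightarrow> j \<in> S \<Longrightarrow> i \<noteq> j \<Longrightarrow> a i j = 0 \<or> a i j = -1"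
begin

definition pairing :: "'i \<Rightarrow> ('i \<Rightarrow> int) \<Rightarrow> int" where
  "pairing i v = (\<Sum>j\<in>S. a i j * v j)"

definition refl :: "'i \<Rightarrow> ('i \<Rightarrow> int) \<Rightarrow> 'i \<Rightarrow> int" where
  "refl i v = (\<lambda>k. v k - pairing i v * simple_root i k)"

lemma refl_apply: "refl i v k = v k - pairing i v * simple_root i k"
  by (simp add: refl_def)

definition act :: "'i list \<Rightarrow> ('i \<Rightarrow> int) \<Rightarrow> 'i \<Rightarrow> int" where
  "act u = foldr (\<lambda>i f. refl i \<circ> f) u id"

lemma act_Nil [simp]: "act [] = id"
  and act_Cons: "act (i # u) = refl i \<circ> act u"
  by (simp_all add: act_def)

lemma act_append: "act (u @ v) = act u \<circ> act v"
  by (induction u) (simp_all add: act_Cons comp_assoc)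

lemma pairing_linear: "pairing i (\<lambda>k. x k + c * y k) = pairing i x + c * pairing i y"
  by (simp add: pairing_def sum.distrib sum_distrib_left algebra_simps)

lemma pairing_root: "j \<in> S \<Longrightarrow> pairing i (simple_root j) = a i j"
  by (simp add: pairing_def simple_root_def finite_S if_distrib cong: if_cong)

lemma pairing_refl: "j \<in> S \<Longrightarrow> pairing i (refl j v) = pairing i v - a i j * pairing j v"
  using pairing_linear[of i v "- pairing j v" "simple_root j"] pairing_root[of j i]
  by (simp add: refl_def mult.commute)

lemma refl_linear: "refl i (\<lambda>k. x k + c * y k) = (\<lambda>k. refl i x k + c * refl i y k)"
  by (simp add: refl_def pairing_linear algebra_simps)

lemma act_linear: "act u (\<lambda>k. x k + c * y k) = (\<lambda>k. act u x k + c * act u y k)"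
  by (induction u) (simp_all add: act_Cons refl_linear)

lemma act_uminus: "act u (\<lambda>k. - x k) = (\<lambda>k. - act u x k)"
proof -
  \<comment> \<open>\<open>- x = x - 2 x\<close> is of the form to which linearity applies.\<close>
  have "act u (\<lambda>k. x k + (-2) * x k) = (\<lambda>k. act u x k + (-2) * act u x k)"
    by (rule act_linear)
  then show ?thesis by simp
qed

lemma act_zero: "act u (\<lambda>k. 0) = (\<lambda>k. 0)"
  using act_uminus[of u "\<lambda>k. 0"] by (auto simp: fun_eq_iff)

lemma refl_root: "j \<in> S \<Longrightarrow> refl i (simple_root j) = (\<lambda>k. simple_root j k + (- a i j) * simple_root i k)"
  by (simp add: refl_def pairing_root)

lemma refl_self: "i \<in> S \<Longrightarrow> refl i (simple_root i) = (\<lambda>k. - simple_root i k)"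
  by (simp add: refl_root a_diag)

lemma refl_refl: "i \<in> S \<Longrightarrow> refl i (refl i v) = v"
  by (simp add: fun_eq_iff refl_apply pairing_refl a_diag)

lemma act_square: "i \<in> S \<Longrightarrow> act [i, i] = id"
  by (auto simp: act_Cons refl_refl)

lemma act_commute:
  assumes "i \<in> S" "j \<in> S" "a i j = 0"
  shows "act [i, j] = act [j, i]"
proof -
  have "a j i = 0" using assms a_sym by simp
  then show ?thesis using assms
    by (simp add: act_Cons fun_eq_iff refl_apply pairing_refl)
qed

lemma act_braid:
  assumes "i \<in> S" "j \<in> S" "a i j = -1"
  shows "act [i, j, i] = act [j, i, j]"
proof -
  have "a j i = -1" using assms a_sym by simp
  moreover have "refl i (refl j (refl i v)) k = refl j (refl i (refl j v)) k" for v k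
    using assms calculation
    by (simp add: refl_apply pairing_refl a_diag algebra_simps)
  ultimately show ?thesis by (simp add: act_Cons fun_eq_iff)
qed

lemma act_rev_cancel: "set u \<subseteq> S \<Longrightarrow> act (rev u @ u) = id"
proof (induction u)
  case (Cons i u)
  have "act (rev (i # u) @ i # u) = act (rev u) \<circ> act [i, i] \<circ> act u"
    by (simp add: act_append act_Cons comp_assoc)
  then show ?case using Cons by (simp add: act_square act_append)
qed simp

lemma act_cancel_rev: "set u \<subseteq> S \<Longrightarrow> act (u @ rev u) = id"
  using act_rev_cancel[of "rev u"] by simp

lemma act_nonzero:
  assumes "set u \<subseteq> S" "act u v = (\<lambda>k. 0)"
  shows "v = (\<lambda>k. 0)"
proof -
  have "act (rev u @ u) v = (\<lambda>k. 0)" by (simp add: act_append assms(2) act_zero)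
  then show ?thesis using act_rev_cancel[OF assms(1)] by simp
qed

end

section \<open>Lengths and signs of roots\<close>

definition nonneg :: "('i \<Rightarrow> int) \<Rightarrow> bool" where
  "nonneg v \<longleftrightarrow> (\<forall>k. v k \<ge> 0)"

definition nonpos :: "('i \<Rightarrow> int) \<Rightarrow> bool" where
  "nonpos v \<longleftrightarrow> (\<forall>k. v k \<le> 0)"

lemma nonneg_add: "nonneg x \<Longrightarrow> nonneg y \<Longrightarrow> c \<ge> 0 \<Longrightarrow> nonneg (\<lambda>k. x k + c * y k)"
  by (simp add: nonneg_def)

lemma nonneg_uminus: "nonneg (\<lambda>k. - x k) \<longleftrightarrow> nonpos x"
  by (simp add: nonneg_def nonpos_def)

lemma nonneg_nonpos: "nonneg x \<Longrightarrow> nonpos x \<Longrightarrow> x = (\<lambda>k. 0)"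
  by (simp add: nonneg_def nonpos_def fun_eq_iff order_antisym)

lemma nonneg_root: "nonneg (simple_root i)"
  by (simp add: nonneg_def simple_root_def)

lemma root_nonzero: "simple_root i \<noteq> (\<lambda>k. 0)"
  by (simp add: simple_root_def fun_eq_iff)

text \<open>An abstract evaluation \<open>\<phi>\<close> of words that satisfies the Coxeter relations and is no coarser than the
evaluation \<open>act\<close> in the Tits representation. It is used with two evaluations: the class of a word
in the presented group, where faithfulness of the representation is the goal, and \<open>act\<close> itself
restricted to a subset \<open>J\<close> of the generators, which gives the theory of the parabolic subgroups.\<close>

locale word_group = simply_laced S a for S :: "'i set" and a +
  fixes J :: "'i set" and \<phi> :: "'i list \<Rightarrow> 'g"
  assumes J_subset: "J \<subseteq> S"
    and cong: "\<phi> u = \<phi> v \<Longrightarrow> u \<in> lists J \<Longrightarrow> v \<in> lists J \<Longrightarrow> x \<in> lists J \<Longrightarrow> y \<in> lists J \<Longrightarrow>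
      \<phi> (x @ u @ y) = \<phi> (x @ v @ y)"
    and square: "i \<in> J \<Longrightarrow> \<phi> [i, i] = \<phi> []"
    and commute: "i \<in> J \<Longrightarrow> j \<in> J \<Longrightarrow> a i j = 0 \<Longrightarrow> \<phi> [i, j] = \<phi> [j, i]"
    and braid: "i \<in> J \<Longrightarrow> j \<in> J \<Longrightarrow> a i j = -1 \<Longrightarrow> \<phi> [i, j, i] = \<phi> [j, i, j]"
    and act_eq: "\<phi> u = \<phi> v \<Longrightarrow> u \<in> lists J \<Longrightarrow> v \<in> lists J \<Longrightarrow> act u = act v"
begin

definition wlen :: "'i list \<Rightarrow> nat" where
  "wlen u = (LEAST k. \<exists>v\<in>lists J. length v = k \<and> \<phi> v = \<phi> u)"

lemma wlen_cong: "\<phi> u = \<phi> v \<Longrightarrow> wlen u = wlen v"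
  by (simp add: wlen_def)

lemma reduced_word:
  assumes "u \<in> lists J"
  obtains v where "v \<in> lists J" "length v = wlen u" "\<phi> v = \<phi> u"
proof -
  have "\<exists>k. \<exists>v\<in>lists J. length v = k \<and> \<phi> v = \<phi> u" using assms by blast
  from LeastI_ex[OF this] show ?thesis using that by (auto simp: wlen_def)
qed

lemma wlen_le: "v \<in> lists J \<Longrightarrow> \<phi> v = \<phi> u \<Longrightarrow> wlen u \<le> length v"
  unfolding wlen_def by (rule Least_le) blast

lemma S_if_J: "i \<in> J \<Longrightarrow> i \<in> S" using J_subset by blast

lemma cancel: "u \<in> lists J \<Longrightarrow> s \<in> J \<Longrightarrow> \<phi> (u @ [s, s]) = \<phi> u"
  using cong[OF square, of s u "[]"] by simp

lemma wlen_snoc_le: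
  assumes "u \<in> lists J" "s \<in> J"
  shows "wlen (u @ [s]) \<le> wlen u + 1"
proof -
  obtain v where v: "v \<in> lists J" "length v = wlen u" "\<phi> v = \<phi> u"
    using reduced_word assms(1) by blast
  have "\<phi> (v @ [s]) = \<phi> (u @ [s])" using cong[OF v(3), of "[]" "[s]"] assms v by simp
  from wlen_le[OF _ this] show ?thesis using v assms by simp
qed

lemma wlen_snoc_snoc: "u \<in> lists J \<Longrightarrow> s \<in> J \<Longrightarrow> wlen (u @ [s, s]) = wlen u"
  by (rule wlen_cong[OF cancel])

text \<open>The link between length and signs of roots: if appending \<open>s\<close> does not shorten \<open>u\<close>, then \<open>u\<close> maps
the simple root of \<open>s\<close> to a positive root. Induction on the length of \<open>u\<close>. Take a reduced word
\<open>v t\<close> for \<open>u\<close>; then \<open>t \<noteq> s\<close>. If \<open>v s\<close> is not shorter than \<open>v\<close>, then \<open>v\<close> keeps both simple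
roots positive, and \<open>t\<close> maps the root of \<open>s\<close> to a nonnegative combination of the two. If \<open>v s\<close> is
shorter, write \<open>v = x s\<close> with \<open>x\<close> shorter than \<open>v\<close>: when \<open>s\<close> and \<open>t\<close> commute, \<open>u s = x t\<close> would be
too short, and otherwise \<open>s t\<close> maps the root of \<open>s\<close> to that of \<open>t\<close>, which \<open>x\<close> keeps positive because
\<open>u s = x s t s = x t s t\<close> is long.\<close>

lemma nonneg_if_wlen_le:
  assumes "u \<in> lists J" "s \<in> J" "wlen u \<le> wlen (u @ [s])"
  shows "nonneg (act u (simple_root s))"
  using assms
proof (induction "wlen u" arbitrary: u s rule: less_induct)
  case less
  obtain w where w: "w \<in> lists J" "length w = wlen u" "\<phi> w = \<phi> u"
    using reduced_word less.prems(1) by blast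
  have aw: "act u = act w" using act_eq[of u w] w less.prems by simp
  have wl: "wlen w = wlen u" using w(3) by (rule wlen_cong)
  have us: "\<phi> (w @ [s]) = \<phi> (u @ [s])" using cong[OF w(3), of "[]" "[s]"] less.prems w by simp
  have ws: "wlen (w @ [s]) = wlen (u @ [s])" by (rule wlen_cong[OF us])
  show ?case
  proof (cases w rule: rev_cases)
    case Nil
    then show ?thesis by (simp add: aw nonneg_root)
  next
    case (snoc v t)
    have v: "v \<in> lists J" "t \<in> J" using w snoc by auto
    have lv: "wlen v + 1 = wlen u"
      using wlen_le[of v v] wlen_snoc_le[of v t] v w(2) wl snoc by simp
    have ts: "t \<noteq> s"
      using wlen_snoc_snoc[OF v] ws snoc less.prems(3) lv by auto
    have root: "act u (simple_root s) =
        (\<lambda>k. act v (simple_root s) k + (- a t s) * act v (simple_root t) k)"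
    proof -
      have "act u (simple_root s) = act v (refl t (simple_root s))"
        by (simp add: aw snoc act_append act_Cons)
      also have "\<dots> = act v (\<lambda>k. simple_root s k + (- a t s) * simple_root t k)"
        using refl_root[OF S_if_J[OF \<open>s \<in> J\<close>], of t] by (rule arg_cong)
      finally show ?thesis by (subst (asm) act_linear)
    qed
    have ats: "a t s = 0 \<or> a t s = -1" using a_off ts S_if_J v(2) less.prems(2) by blast
    show ?thesis
    proof (cases "wlen v \<le> wlen (v @ [s])")
      case True
      have "nonneg (act v (simple_root s))" using less.hyps[of v s] lv v less.prems True by simp
      moreover have "nonneg (act v (simple_root t))"
        using less.hyps[of v t] lv v wl snoc by simp
      moreover have "- a t s \<ge> 0" using ats by linarith
      ultimately show ?thesis by (simp only: root nonneg_add)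
    next
      case False
      obtain x where x: "x \<in> lists J" "length x = wlen (v @ [s])" "\<phi> x = \<phi> (v @ [s])"
        using reduced_word[of "v @ [s]"] v less.prems by auto
      have xl: "wlen x = wlen (v @ [s])" by (rule wlen_cong[OF x(3)])
      have "\<phi> (x @ [s]) = \<phi> (v @ [s, s])"
        using cong[OF x(3), of "[]" "[s]"] x v less.prems by simp
      then have xs: "\<phi> (x @ [s]) = \<phi> v" using cancel[OF v(1) less.prems(2)] by simp
      from ats show ?thesis
      proof
        assume comm: "a t s = 0"
        have "\<phi> (v @ [t, s]) = \<phi> (v @ [s, t])"
          using cong[OF commute[OF v(2) less.prems(2) comm], of v "[]"] v less.prems by simp
        then have "wlen (w @ [s]) = wlen (v @ [s, t])" using wlen_cong[of "w @ [s]" "v @ [s, t]"] snoc by simp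
        moreover have "wlen ((v @ [s]) @ [t]) \<le> wlen (v @ [s]) + 1"
          using v less.prems by (intro wlen_snoc_le) auto
        ultimately show ?thesis using False lv ws less.prems(3) by simp
      next
        assume br: "a t s = -1"
        have "\<phi> (x @ [s, t, s]) = \<phi> (x @ [t, s, t])"
          using cong[OF braid[OF v(2) less.prems(2) br], of x "[]"] x v less.prems by simp
        moreover have "\<phi> (x @ [s, t, s]) = \<phi> (w @ [s])"
          using cong[OF xs, of "[]" "[t, s]"] x v less.prems snoc by simp
        ultimately have "wlen (w @ [s]) = wlen (x @ [t, s, t])" by (intro wlen_cong) simp
        moreover have "wlen ((x @ [t, s]) @ [t]) \<le> wlen (x @ [t, s]) + 1"
          using x v less.prems by (intro wlen_snoc_le) auto
        moreover have "wlen ((x @ [t]) @ [s]) \<le> wlen (x @ [t]) + 1"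
          using x v less.prems by (intro wlen_snoc_le) auto
        ultimately have "wlen x \<le> wlen (x @ [t])"
          using less.prems(3) ws False xl lv by simp
        then have "nonneg (act x (simple_root t))"
          using less.hyps[of x t] x v xl False lv by simp
        moreover have "act v = act x \<circ> refl s"
          using act_eq[OF xs] x v less.prems by (simp add: act_append act_Cons)
        then have "act v (simple_root s) = (\<lambda>k. - act x (simple_root s) k)"
          and "act v (simple_root t) = (\<lambda>k. act x (simple_root t) k + 1 * act x (simple_root s) k)"
          using refl_self[of s] refl_root[of t s] S_if_J less.prems(2) v(2) a_sym[of s t] br
            act_uminus[of x "simple_root s"] act_linear[of x "simple_root t" 1 "simple_root s"]
          by simp_all
        then have "act u (simple_root s) = act x (simple_root t)"
          unfolding root br by simp
        ultimately show ?thesis by simp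
      qed
    qed
  qed
qed

lemma act_snoc_root:
  assumes "s \<in> J" shows "act (u @ [s]) (simple_root s) = (\<lambda>k. - act u (simple_root s) k)"
  using S_if_J[OF assms] by (simp add: act_append act_Cons refl_self act_uminus)

text \<open>Equal lengths of \<open>u\<close> and \<open>u s\<close> are impossible: \<open>nonneg_if_wlen_le\<close>, applied to both words, would make
the image of the simple root nonnegative and nonpositive at once.\<close>

lemma wlen_trichotomy:
  assumes u: "u \<in> lists J" and s: "s \<in> J"
  shows "nonneg (act u (simple_root s)) \<and> \<not> nonpos (act u (simple_root s)) \<and> wlen (u @ [s]) = wlen u + 1 \<or>
    nonpos (act u (simple_root s)) \<and> \<not> nonneg (act u (simple_root s)) \<and> wlen (u @ [s]) + 1 = wlen u"
proof -
  have us: "u @ [s] \<in> lists J" using u s by simp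
  have nz: "\<not> (nonneg (act u (simple_root s)) \<and> nonpos (act u (simple_root s)))"
    using nonneg_nonpos act_nonzero[of u "simple_root s"] u J_subset root_nonzero by (metis in_listsD subset_iff)
  have A: "wlen u \<le> wlen (u @ [s]) \<Longrightarrow> nonneg (act u (simple_root s))"
    using nonneg_if_wlen_le u s by blast
  have B: "wlen (u @ [s]) \<le> wlen u \<Longrightarrow> nonpos (act u (simple_root s))"
    using nonneg_if_wlen_le[OF us s] wlen_snoc_snoc[OF u s]
    by (simp add: act_snoc_root s nonneg_uminus)
  have C: "wlen (u @ [s]) \<le> wlen u + 1" "wlen u \<le> wlen (u @ [s]) + 1"
    using wlen_snoc_le[OF u s] wlen_snoc_le[OF us s] wlen_snoc_snoc[OF u s] by simp_all
  show ?thesis using nz A B C by (cases "wlen u" "wlen (u @ [s])" rule: linorder_cases) auto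
qed

text \<open>The last letter of a nonempty reduced word is always a descent.\<close>

lemma no_descent_trivial:
  assumes u: "u \<in> lists J" and "\<And>s. s \<in> J \<Longrightarrow> nonneg (act u (simple_root s))"
  shows "\<phi> u = \<phi> []"
proof -
  obtain w where w: "w \<in> lists J" "length w = wlen u" "\<phi> w = \<phi> u"
    using reduced_word u by blast
  show ?thesis
  proof (cases w rule: rev_cases)
    case Nil then show ?thesis using w by simp
  next
    case (snoc v t)
    then have v: "v \<in> lists J" "t \<in> J" using w by auto
    have "nonneg (act (v @ [t]) (simple_root t))"
      using act_eq[OF w(3)] w u assms(2) v snoc by simp
    then have "nonpos (act v (simple_root t))" by (simp add: act_snoc_root v nonneg_uminus)
    then have "wlen (v @ [t]) + 1 = wlen v" using wlen_trichotomy[OF v] by auto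
    then show ?thesis using w snoc wlen_le[of v v] v wlen_cong[OF w(3)] by simp
  qed
qed

text \<open>If \<open>u\<close> and \<open>v\<close> act equally, then \<open>v\<inverse> u\<close> acts as the identity, keeps every simple root positive,
and therefore has length 0.\<close>

theorem faithful:
  assumes u: "u \<in> lists J" and v: "v \<in> lists J" and uv: "act u = act v"
  shows "\<phi> u = \<phi> v"
proof -
  have revJ: "rev v \<in> lists J" using v by (simp add: lists_eq_set)
  have cancel_rev: "x \<in> lists J \<Longrightarrow> \<phi> (x @ rev x) = \<phi> []" for x
  proof (induction x)
    case (Cons i x)
    have "\<phi> ([i] @ (x @ rev x) @ [i]) = \<phi> ([i] @ [] @ [i])"
      using Cons by (intro cong) (auto simp: lists_eq_set)
    then show ?case using Cons square by simp
  qed simp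
  have "act (rev v @ u) = id"
    using act_rev_cancel[of v] v J_subset uv by (auto simp: act_append lists_eq_set)
  then have "\<phi> (rev v @ u) = \<phi> []"
    using u revJ by (intro no_descent_trivial) (simp_all add: nonneg_root)
  then have "\<phi> (v @ (rev v @ u) @ []) = \<phi> (v @ [] @ [])"
    using u v revJ by (intro cong) auto
  moreover have "\<phi> ([] @ (v @ rev v) @ u) = \<phi> ([] @ [] @ u)"
    using u v revJ by (intro cong cancel_rev) auto
  ultimately show ?thesis by simp
qed

end

section \<open>Parabolic subgroups and minimal coset representatives\<close>

context simply_laced
begin

lemma word_group_act: "J \<subseteq> S \<Longrightarrow> word_group S a J act"
  by unfold_locales
    (auto simp: act_append act_square subset_iff intro: act_commute act_braid)

text \<open>Lengths in the parabolic subgroup \<open>W J\<close> are taken with respect to \<open>J\<close>; they agree with lengths in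
larger subgroups by the case \<open>g = id\<close> of \<open>len_min_coset\<close> below.\<close>

definition W :: "'i set \<Rightarrow> (('i \<Rightarrow> int) \<Rightarrow> 'i \<Rightarrow> int) set" where
  "W J = act ` lists J"

definition len :: "'i set \<Rightarrow> (('i \<Rightarrow> int) \<Rightarrow> 'i \<Rightarrow> int) \<Rightarrow> nat" where
  "len J f = (LEAST k. \<exists>u\<in>lists J. length u = k \<and> act u = f)"

lemma wlen_act: "J \<subseteq> S \<Longrightarrow> word_group.wlen J act u = len J (act u)"
  by (simp add: word_group.wlen_def[OF word_group_act] len_def)

lemma refl_involution: "i \<in> S \<Longrightarrow> refl i \<circ> refl i = id"
  by (simp add: fun_eq_iff refl_refl)

lemma W_id: "id \<in> W J"
  unfolding W_def by (rule image_eqI[of _ _ "[]"]) simp_all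

lemma W_refl: "s \<in> J \<Longrightarrow> refl s \<in> W J"
  unfolding W_def by (rule image_eqI[of _ _ "[s]"]) (simp_all add: act_Cons)

lemma W_comp:
  assumes "f \<in> W J" "g \<in> W J" shows "f \<circ> g \<in> W J"
proof -
  obtain u v where "u \<in> lists J" "v \<in> lists J" "f = act u" "g = act v"
    using assms by (auto simp: W_def)
  then show ?thesis unfolding W_def by (intro image_eqI[of _ _ "u @ v"]) (simp_all add: act_append)
qed

lemma W_mono: "I \<subseteq> J \<Longrightarrow> W I \<subseteq> W J"
  unfolding W_def by (intro image_mono lists_mono)

lemma W_inverse:
  assumes "f \<in> W J" "J \<subseteq> S"
  obtains g where "g \<in> W J" "g \<circ> f = id" "f \<circ> g = id"
proof -
  obtain u where u: "u \<in> lists J" "f = act u" using assms by (auto simp: W_def)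
  have "act (rev u) \<in> W J" using u by (auto simp: W_def)
  then show ?thesis
    using that act_rev_cancel[of u] act_cancel_rev[of u] u assms(2)
    by (auto simp: act_append lists_eq_set)
qed

lemma reduced_word:
  assumes "f \<in> W J"
  obtains u where "u \<in> lists J" "length u = len J f" "act u = f"
proof -
  have "\<exists>k. \<exists>u\<in>lists J. length u = k \<and> act u = f" using assms by (auto simp: W_def)
  from LeastI_ex[OF this] show ?thesis using that by (auto simp: len_def)
qed

lemma len_le: "u \<in> lists J \<Longrightarrow> len J (act u) \<le> length u"
  unfolding len_def by (rule Least_le) blast

lemma len_id: "len J id = 0"
  using len_le[of "[]" J] by simp

lemma len_identity: "len J (\<lambda>x. x) = 0"
  using len_id[of J] by (simp add: id_def)

lemma len_eq_0_iff: "f \<in> W J \<Longrightarrow> len J f = 0 \<longleftrightarrow> f = id"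
  by (metis reduced_word len_id length_0_conv act_Nil)

lemma len_trichotomy:
  assumes f: "f \<in> W J" and s: "s \<in> J" and J: "J \<subseteq> S"
  shows "nonneg (f (simple_root s)) \<and> \<not> nonpos (f (simple_root s)) \<and> len J (f \<circ> refl s) = len J f + 1 \<or>
    nonpos (f (simple_root s)) \<and> \<not> nonneg (f (simple_root s)) \<and> len J (f \<circ> refl s) + 1 = len J f"
proof -
  obtain u where u: "u \<in> lists J" "f = act u" using f by (auto simp: W_def)
  have "act (u @ [s]) = f \<circ> refl s" by (simp add: u act_append act_Cons)
  then show ?thesis
    using word_group.wlen_trichotomy[OF word_group_act[OF J] u(1) s] wlen_act[OF J]
    by (simp add: u(2))
qed

lemma no_descent_id:
  assumes f: "f \<in> W J" and J: "J \<subseteq> S" and "\<And>s. s \<in> J \<Longrightarrow> nonneg (f (simple_root s))"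
  shows "f = id"
proof -
  obtain u where u: "u \<in> lists J" "f = act u" using f by (auto simp: W_def)
  show ?thesis
    using word_group.no_descent_trivial[OF word_group_act[OF J] u(1)] assms(3) u(2) by simp
qed

lemma W_supported:
  assumes "f \<in> W I" "\<And>k. k \<notin> I \<Longrightarrow> v k = 0" "k \<notin> I"
  shows "f v k = 0"
proof -
  have "act u v k = 0" if "u \<in> lists I" for u
    using that
  proof (induction u)
    case (Cons i u)
    then show ?case using assms(3) by (auto simp: act_Cons refl_apply simple_root_def)
  qed (use assms in auto)
  then show ?thesis using assms(1) by (auto simp: W_def)
qed

lemma W_uminus: "f \<in> W J \<Longrightarrow> f (\<lambda>k. - x k) = (\<lambda>k. - f x k)"
  by (auto simp: W_def act_uminus)

lemma W_linear: "f \<in> W J \<Longrightarrow> f (\<lambda>k. x k + c * y k) = (\<lambda>k. f x k + c * f y k)"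
  by (auto simp: W_def act_linear)

lemma linear_nonneg:
  assumes lin: "\<And>x c y. F (\<lambda>k. x k + c * y k) = (\<lambda>k. F x k + c * F y k)"
    and "finite I" and "\<And>s. s \<in> I \<Longrightarrow> nonneg (F (simple_root s))"
    and "nonneg v" and "\<And>k. k \<notin> I \<Longrightarrow> v k = 0"
  shows "nonneg (F v)"
  using assms(2-)
proof (induction I arbitrary: v rule: finite_induct)
  case empty
  then have "v = (\<lambda>k. 0)" by auto
  then show ?case using lin[of "\<lambda>k. 0" "-1" "\<lambda>k. 0"] by (auto simp: nonneg_def fun_eq_iff)
next
  case (insert s I)
  have "nonneg (F (v(s := 0)))"
    by (rule insert.IH) (use insert.prems in \<open>auto simp: nonneg_def\<close>)
  then have "nonneg (\<lambda>k. F (v(s := 0)) k + v s * F (simple_root s) k)"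
    using insert.prems by (intro nonneg_add) (auto simp: nonneg_def)
  also have "(\<lambda>k. F (v(s := 0)) k + v s * F (simple_root s) k) = F (\<lambda>k. (v(s := 0)) k + v s * simple_root s k)"
    by (rule lin[symmetric])
  also have "(\<lambda>k. (v(s := 0)) k + v s * simple_root s k) = v"
    by (auto simp: simple_root_def)
  finally show ?case .
qed

lemma W_nonneg:
  assumes "f \<in> W J" "I \<subseteq> S" "\<And>s. s \<in> I \<Longrightarrow> nonneg (f (simple_root s))"
    "nonneg v" "\<And>k. k \<notin> I \<Longrightarrow> v k = 0"
  shows "nonneg (f v)"
  by (rule linear_nonneg[where F = f and I = I])
    (use assms finite_subset[OF assms(2) finite_S] W_linear[OF assms(1)] in auto)

lemma W_nonpos:
  assumes "f \<in> W J" "I \<subseteq> S" "\<And>s. s \<in> I \<Longrightarrow> nonpos (f (simple_root s))"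
    "nonneg v" "\<And>k. k \<notin> I \<Longrightarrow> v k = 0"
  shows "nonpos (f v)"
proof -
  have "nonneg (\<lambda>k. - f v k)"
    by (rule linear_nonneg[where F = "\<lambda>v k. - f v k" and I = I])
      (use assms finite_subset[OF assms(2) finite_S] W_linear[OF assms(1)] in \<open>auto simp: nonneg_uminus algebra_simps\<close>)
  then show ?thesis by (simp add: nonneg_uminus)
qed

text \<open>The minimal length representatives of the cosets \<open>w W I\<close> in \<open>W J\<close>, characterized by the absence of
descents in \<open>I\<close>.\<close>

definition min_coset :: "'i set \<Rightarrow> 'i set \<Rightarrow> (('i \<Rightarrow> int) \<Rightarrow> 'i \<Rightarrow> int) set" where
  "min_coset J I = {f \<in> W J. \<forall>s\<in>I. nonneg (f (simple_root s))}"

lemma min_coset_nonneg: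
  assumes "g \<in> min_coset J I" "h \<in> W I" "s \<in> I" "I \<subseteq> S" "nonneg (h (simple_root s))"
  shows "nonneg (g (h (simple_root s)))"
proof (rule W_nonneg[where f = g and J = J and I = I and v = "h (simple_root s)"])
  show "g \<in> W J" using assms by (simp add: min_coset_def)
  show "I \<subseteq> S" by (rule assms(4))
  show "h (simple_root s) k = 0" if "k \<notin> I" for k
    by (rule W_supported[OF assms(2) _ that]) (use assms(3) in \<open>auto simp: simple_root_def\<close>)
qed (use assms in \<open>auto simp: min_coset_def\<close>)

text \<open>As long as some \<open>s\<close> in \<open>I\<close> is a descent of \<open>f\<close>, replace \<open>f\<close> by the shorter \<open>f s\<close>.\<close>

lemma min_coset_decompose:
  assumes "f \<in> W J" "I \<subseteq> J" "J \<subseteq> S"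
  shows "\<exists>g\<in>min_coset J I. \<exists>h\<in>W I. f = g \<circ> h"
  using assms(1)
proof (induction "len J f" arbitrary: f rule: less_induct)
  case less
  show ?case
  proof (cases "f \<in> min_coset J I")
    case True
    then show ?thesis using W_id by (intro bexI[of _ f] bexI[of _ id]) auto
  next
    case False
    then obtain s where s: "s \<in> I" "\<not> nonneg (f (simple_root s))"
      using less.prems by (auto simp: min_coset_def)
    have sJ: "s \<in> J" "s \<in> S" using s assms by auto
    have "len J (f \<circ> refl s) < len J f" using len_trichotomy[OF less.prems sJ(1) assms(3)] s by auto
    then obtain g h where gh: "g \<in> min_coset J I" "h \<in> W I" "f \<circ> refl s = g \<circ> h"
      using less.hyps W_comp[OF less.prems W_refl[OF sJ(1)]] by blast
    have "f = f \<circ> refl s \<circ> refl s" using refl_involution[OF sJ(2)] by (simp add: comp_assoc)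
    then have "f = g \<circ> (h \<circ> refl s)" using gh(3) by (simp add: comp_assoc)
    then show ?thesis using gh W_comp[OF gh(2) W_refl[OF s(1)]] by blast
  qed
qed

text \<open>Build \<open>h\<close> letter by letter. Each new letter sends its simple root to a positive root with support in
\<open>I\<close>, which \<open>g\<close> keeps positive; so the length in \<open>J\<close> also grows by one.\<close>

lemma len_min_coset:
  assumes g: "g \<in> min_coset J I" and h: "h \<in> W I" and IJ: "I \<subseteq> J" "J \<subseteq> S"
  shows "len J (g \<circ> h) = len J g + len I h"
  using h
proof (induction "len I h" arbitrary: h)
  case 0
  then have "h = id" using len_eq_0_iff by metis
  then show ?case by (simp add: len_identity)
next
  case (Suc n)
  have I: "I \<subseteq> S" using IJ by blast
  have "h \<noteq> id" using Suc.hyps(2) len_id by auto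
  then obtain s where s: "s \<in> I" "\<not> nonneg (h (simple_root s))"
    using no_descent_id[OF Suc.prems I] by blast
  have sJ: "s \<in> J" "s \<in> S" using s IJ by auto
  define h' where "h' = h \<circ> refl s"
  have h': "h' \<in> W I" unfolding h'_def using Suc.prems s W_comp W_refl by blast
  have h: "h = h' \<circ> refl s" unfolding h'_def using refl_involution[OF sJ(2)] by (simp add: comp_assoc)
  have len: "len I h' + 1 = len I h"
    using len_trichotomy[OF Suc.prems s(1) I] s unfolding h'_def by auto
  then have "nonneg (h' (simple_root s))" using len_trichotomy[OF h' s(1) I] h by auto
  then have "nonneg ((g \<circ> h') (simple_root s))" using min_coset_nonneg[OF g h' s(1) I] by simp
  moreover have "g \<circ> h' \<in> W J" using g h' W_mono[OF IJ(1)] by (auto intro!: W_comp simp: min_coset_def)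
  ultimately have "len J ((g \<circ> h') \<circ> refl s) = len J (g \<circ> h') + 1"
    using len_trichotomy[of "g \<circ> h'" J s] sJ(1) IJ(2) by auto
  moreover have "len J (g \<circ> h') = len J g + len I h'"
    using Suc.hyps(1)[of h'] Suc.hyps(2) h' len by simp
  ultimately show ?case using len h by (simp add: comp_assoc)
qed

text \<open>With \<open>g = g' m\<close> for \<open>m = h' h\<inverse>\<close> in \<open>W I\<close>, a descent \<open>s\<close> of \<open>m\<close> would be a descent of \<open>g\<close> in \<open>I\<close>,
because \<open>g'\<close> preserves the sign of vectors with support in \<open>I\<close>.\<close>

lemma min_coset_unique:
  assumes g: "g \<in> min_coset J I" "g' \<in> min_coset J I" and h: "h \<in> W I" "h' \<in> W I"
    and IJ: "I \<subseteq> J" "J \<subseteq> S" and eq: "g \<circ> h = g' \<circ> h'"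
  shows "g = g' \<and> h = h'"
proof -
  have I: "I \<subseteq> S" using IJ by blast
  obtain k where k: "k \<in> W I" "k \<circ> h = id" "h \<circ> k = id" using W_inverse[OF h(1) I] by blast
  define m where "m = h' \<circ> k"
  have m: "m \<in> W I" unfolding m_def using h k W_comp by blast
  have gm: "g = g' \<circ> m" unfolding m_def
    by (metis comp_assoc comp_id eq k(3))
  have "nonneg (m (simple_root s))" if s: "s \<in> I" for s
  proof (rule ccontr)
    assume "\<not> nonneg (m (simple_root s))"
    then have "nonneg (\<lambda>k. - m (simple_root s) k)"
      using len_trichotomy[OF m s I] by (simp add: nonneg_uminus)
    moreover have "(\<lambda>k. - m (simple_root s) k) = (m \<circ> refl s) (simple_root s)"
      using s I m by (simp add: refl_self W_uminus subset_iff)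
    ultimately have "nonneg (g' ((m \<circ> refl s) (simple_root s)))"
      using min_coset_nonneg[OF g(2) W_comp[OF m W_refl[OF s]] s I] by simp
    also have "g' ((m \<circ> refl s) (simple_root s)) = (\<lambda>k. - g (simple_root s) k)"
      using s I m g(2) by (simp add: refl_self W_uminus[of _ I] W_uminus[of _ J] subset_iff gm min_coset_def)
    finally have "nonpos (g (simple_root s))" by (simp add: nonneg_uminus)
    moreover have "g \<in> W J" "nonneg (g (simple_root s))" using g(1) s by (simp_all add: min_coset_def)
    ultimately show False using len_trichotomy[of g J s] s IJ by auto
  qed
  then have "m = id" using no_descent_id[OF m I] by blast
  then have "g = g'" "h' = h" using gm k unfolding m_def by (simp, metis comp_assoc comp_id id_comp)
  then show ?thesis by simp
qed

text \<open>For \<open>X = W J\<close> this is the Poincare series of the parabolic subgroup.\<close>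

definition length_series :: "(('i \<Rightarrow> int) \<Rightarrow> 'i \<Rightarrow> int) set \<Rightarrow> 'i set \<Rightarrow> rat fps" where
  "length_series X J = Abs_fps (\<lambda>k. of_nat (card {f \<in> X. len J f = k}))"

lemma finite_len:
  assumes "J \<subseteq> S"
  shows "finite {f \<in> W J. len J f = k}"
proof (rule finite_subset)
  show "{f \<in> W J. len J f = k} \<subseteq> act ` {u. set u \<subseteq> J \<and> length u = k}"
    by (auto elim!: reduced_word simp: lists_eq_set image_iff)
  show "finite (act ` {u. set u \<subseteq> J \<and> length u = k})"
    using assms finite_S finite_subset by (intro finite_imageI finite_lists_length_eq) blast
qed

theorem series_factor:
  assumes IJ: "I \<subseteq> J" "J \<subseteq> S"
  shows "length_series (W J) J = length_series (min_coset J I) J * length_series (W I) I"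
proof (rule fps_ext)
  fix n
  define G where "G k = {f \<in> min_coset J I. len J f = k}" for k
  define H where "H k = {f \<in> W I. len I f = k}" for k
  have fin: "finite (G k)" "finite (H k)" for k
    using finite_subset[OF _ finite_len[OF IJ(2)], of "G k" k] finite_len[of I k] IJ
    by (auto simp: G_def H_def min_coset_def)
  have inj: "inj_on (\<lambda>(g, h). g \<circ> h) (\<Union>k\<in>{0..n}. G k \<times> H (n - k))"
    using min_coset_unique[OF _ _ _ _ IJ] by (auto simp: inj_on_def G_def H_def)
  have "{f \<in> W J. len J f = n} = (\<lambda>(g, h). g \<circ> h) ` (\<Union>k\<in>{0..n}. G k \<times> H (n - k))"
  proof (intro equalityI subsetI)
    fix f assume "f \<in> {f \<in> W J. len J f = n}"
    then obtain g h where gh: "g \<in> min_coset J I" "h \<in> W I" "f = g \<circ> h" and n: "len J f = n"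
      using min_coset_decompose[OF _ IJ] by blast
    have "len J g + len I h = n" using n len_min_coset[OF gh(1,2) IJ] gh by simp
    then have "(g, h) \<in> (\<Union>k\<in>{0..n}. G k \<times> H (n - k))"
      using gh by (auto simp: G_def H_def)
    then show "f \<in> (\<lambda>(g, h). g \<circ> h) ` (\<Union>k\<in>{0..n}. G k \<times> H (n - k))"
      using gh(3) by (intro image_eqI[of _ _ "(g, h)"]) auto
  next
    fix f assume "f \<in> (\<lambda>(g, h). g \<circ> h) ` (\<Union>k\<in>{0..n}. G k \<times> H (n - k))"
    then obtain g h k where gh: "f = g \<circ> h" "k \<le> n" "g \<in> G k" "h \<in> H (n - k)" by auto
    then show "f \<in> {f \<in> W J. len J f = n}"
      using len_min_coset[OF _ _ IJ, of g h] W_comp[of g J h] W_mono[OF IJ(1)]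
      by (auto simp: G_def H_def min_coset_def)
  qed
  then have "card {f \<in> W J. len J f = n} = card (\<Union>k\<in>{0..n}. G k \<times> H (n - k))"
    using card_image[OF inj] by simp
  also have "\<dots> = (\<Sum>k\<in>{0..n}. card (G k \<times> H (n - k)))"
    by (rule card_UN_disjoint) (use fin in \<open>auto simp: G_def\<close>)
  also have "\<dots> = (\<Sum>k=0..n. card (G k) * card (H (n - k)))"
    by (simp add: card_cartesian_product)
  finally show "fps_nth (length_series (W J) J) n = fps_nth (length_series (min_coset J I) J * length_series (W I) I) n"
    by (simp add: length_series_def fps_mult_nth G_def H_def)
qed

definition full_descent :: "'i set \<Rightarrow> (('i \<Rightarrow> int) \<Rightarrow> 'i \<Rightarrow> int) set" where
  "full_descent J = {f \<in> W J. \<forall>s\<in>J. nonpos (f (simple_root s))}"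

text \<open>Expand the product of \<open>1 - 1\<close> over \<open>A\<close>.\<close>

lemma alternating_sum_Pow:
  assumes "finite A"
  shows "(\<Sum>I\<in>Pow A. (-1) ^ card I) = (if A = {} then 1 else 0 :: 'b :: comm_ring_1)"
  using prod_diff_conv_sum[OF assms, of "\<lambda>_. 1" "\<lambda>_. 1 :: 'b"] assms
  by (simp add: power_0_left card_gt_0_iff)

text \<open>Inclusion and exclusion over descent sets: an element \<open>f\<close> is counted for exactly those \<open>I\<close> that consist of
ascents of \<open>f\<close>, and the signs cancel unless \<open>f\<close> has no ascent at all.\<close>

theorem alternating_min_coset:
  assumes J: "J \<subseteq> S"
  shows "(\<Sum>I\<in>Pow J. (-1) ^ card I * length_series (min_coset J I) J) = length_series (full_descent J) J"
proof (rule fps_ext)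
  fix n
  define X where "X = {f \<in> W J. len J f = n}"
  define asc where "asc f = {s \<in> J. nonneg (f (simple_root s))}" for f :: "('i \<Rightarrow> int) \<Rightarrow> 'i \<Rightarrow> int"
  have finJ: "finite J" using J finite_S finite_subset by blast
  have finX: "finite X" unfolding X_def by (rule finite_len[OF J])
  have nth: "fps_nth ((-1) ^ k * F) n = (-1) ^ k * fps_nth F n" for k and F :: "rat fps"
    by (induction k) simp_all
  have "fps_nth (\<Sum>I\<in>Pow J. (-1) ^ card I * length_series (min_coset J I) J) n =
      (\<Sum>I\<in>Pow J. (-1) ^ card I * of_nat (card {f \<in> X. I \<subseteq> asc f}))"
    unfolding fps_sum_nth nth
  proof (intro sum.cong refl)
    fix I assume I: "I \<in> Pow J"
    have "{f \<in> min_coset J I. len J f = n} = {f \<in> X. I \<subseteq> asc f}"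
      using I by (auto simp: min_coset_def X_def asc_def)
    then show "(-1) ^ card I * fps_nth (length_series (min_coset J I) J) n =
        (-1) ^ card I * of_nat (card {f \<in> X. I \<subseteq> asc f})"
      by (simp add: length_series_def)
  qed
  also have "\<dots> = (\<Sum>I\<in>Pow J. \<Sum>f\<in>X. if I \<subseteq> asc f then (-1) ^ card I else 0)"
    using finX by (intro sum.cong refl) (simp add: sum.If_cases Int_def mult.commute)
  also have "\<dots> = (\<Sum>f\<in>X. \<Sum>I\<in>Pow J. if I \<subseteq> asc f then (-1) ^ card I else 0)"
    by (rule sum.swap)
  also have "\<dots> = (\<Sum>f\<in>X. \<Sum>I\<in>Pow (asc f). (-1) ^ card I)"
  proof (rule sum.cong[OF refl])
    fix f :: "('i \<Rightarrow> int) \<Rightarrow> 'i \<Rightarrow> int"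
    have "{I \<in> Pow J. I \<subseteq> asc f} = Pow (asc f)" by (auto simp: asc_def)
    then show "(\<Sum>I\<in>Pow J. if I \<subseteq> asc f then (-1) ^ card I else 0) = (\<Sum>I\<in>Pow (asc f). (-1 :: rat) ^ card I)"
      using finJ by (simp add: sum.inter_filter[symmetric])
  qed
  also have "\<dots> = (\<Sum>f\<in>X. if asc f = {} then 1 else 0)"
    using finJ by (intro sum.cong refl alternating_sum_Pow) (simp add: asc_def)
  also have "\<dots> = of_nat (card {f \<in> X. asc f = {}})"
    using finX by (simp add: sum.If_cases Int_def)
  also have "{f \<in> X. asc f = {}} = {f \<in> full_descent J. len J f = n}"
    using len_trichotomy[OF _ _ J] by (auto simp: X_def asc_def full_descent_def)
  finally show "fps_nth (\<Sum>I\<in>Pow J. (-1) ^ card I * length_series (min_coset J I) J) n =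
      fps_nth (length_series (full_descent J) J) n"
    by (simp add: length_series_def)
qed

lemma series_W_nth_0:
  "fps_nth (length_series (W J) J) 0 = 1"
proof -
  have "f \<in> W J \<and> len J f = 0 \<longleftrightarrow> f = id" for f
    using len_eq_0_iff[of f J] W_id[of J] by auto
  then have "{f \<in> W J. len J f = 0} = {id}" by auto
  then show ?thesis by (simp add: length_series_def)
qed

text \<open>The recursion that determines all Poincare series: divide \<open>alternating_min_coset\<close> by the series of
\<open>W J\<close> and use \<open>series_factor\<close>. The right-hand side is explicit, because an element for which all of \<open>J\<close>
are descents is unique and exists only if \<open>W J\<close> is finite, when it is the longest element.\<close>

theorem inverse_series_recursion:
  assumes J: "J \<subseteq> S"
  shows "(\<Sum>I\<in>Pow J. (-1) ^ card I * inverse (length_series (W I) I)) =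
    length_series (full_descent J) J * inverse (length_series (W J) J)"
proof -
  have inv: "length_series (W I) I * inverse (length_series (W I) I) = 1" for I
    by (rule inverse_mult_eq_1') (simp add: series_W_nth_0)
  have "inverse (length_series (W I) I) = length_series (min_coset J I) J * inverse (length_series (W J) J)" if "I \<in> Pow J" for I
  proof -
    have "length_series (min_coset J I) J * inverse (length_series (W J) J) =
        length_series (min_coset J I) J * (length_series (W I) I * inverse (length_series (W I) I)) * inverse (length_series (W J) J)"
      by (simp add: inv)
    also have "\<dots> = (length_series (W J) J * inverse (length_series (W J) J)) * inverse (length_series (W I) I)"
      using that J by (simp add: series_factor[of I J] mult_ac)
    finally show ?thesis by (simp add: inv)
  qed
  then have "(\<Sum>I\<in>Pow J. (-1) ^ card I * inverse (length_series (W I) I)) =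
      (\<Sum>I\<in>Pow J. ((-1) ^ card I * length_series (min_coset J I) J) * inverse (length_series (W J) J))"
    by (intro sum.cong refl) (simp only: mult.assoc)
  also have "\<dots> = (\<Sum>I\<in>Pow J. (-1) ^ card I * length_series (min_coset J I) J) * inverse (length_series (W J) J)"
    by (rule sum_distrib_right[symmetric])
  finally show ?thesis by (simp only: alternating_min_coset[OF J])
qed

text \<open>Both elements send positive vectors to negative ones, so \<open>f g\<inverse>\<close> keeps all simple roots positive.\<close>

lemma full_descent_unique:
  assumes f: "f \<in> full_descent J" and g: "g \<in> full_descent J" and J: "J \<subseteq> S"
  shows "f = g"
proof -
  have fW: "f \<in> W J" and gW: "g \<in> W J" using f g by (auto simp: full_descent_def)
  obtain k where k: "k \<in> W J" "k \<circ> g = id" "g \<circ> k = id" using W_inverse[OF gW J] by blast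
  have nonpos_image: "nonpos (e v)"
    if "e \<in> full_descent J" "nonneg v" "\<And>k. k \<notin> J \<Longrightarrow> v k = 0" for e v
    by (rule W_nonpos[of e J J]) (use that J in \<open>auto simp: full_descent_def\<close>)
  have "nonneg ((f \<circ> k) (simple_root s))" if s: "s \<in> J" for s
  proof -
    have supp: "k (simple_root s) j = 0" if "j \<notin> J" for j
      by (rule W_supported[OF k(1) _ that]) (use s in \<open>auto simp: simple_root_def\<close>)
    have "g (k (simple_root s)) = simple_root s" using k(3) by (metis comp_apply id_apply)
    then have "\<not> nonpos (g (k (simple_root s)))"
      using nonneg_nonpos[OF nonneg_root, of s] root_nonzero[of s] by auto
    then have "\<not> nonneg (k (simple_root s))"
      using nonpos_image[OF g, of "k (simple_root s)"] supp by blast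
    then have "nonneg (\<lambda>j. - k (simple_root s) j)"
      using len_trichotomy[OF k(1) s J] by (auto simp: nonneg_uminus)
    then have "nonpos (f (\<lambda>j. - k (simple_root s) j))"
      by (rule nonpos_image[OF f]) (simp add: supp)
    then show ?thesis by (simp add: W_uminus[OF fW]) (simp add: nonneg_def nonpos_def)
  qed
  then have "f \<circ> k = id" using no_descent_id[OF W_comp[OF fW k(1)] J] by blast
  then show ?thesis using k(2) by (metis comp_assoc comp_id id_comp)
qed

lemma series_full_descent:
  assumes "f \<in> full_descent J" "J \<subseteq> S"
  shows "length_series (full_descent J) J = fps_X ^ len J f"
proof (rule fps_ext)
  fix n
  have "{g \<in> full_descent J. len J g = n} = (if n = len J f then {f} else {})"
    using full_descent_unique assms by auto
  then show "fps_nth (length_series (full_descent J) J) n = fps_nth (fps_X ^ len J f) n"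
    by (simp add: length_series_def fps_X_power_nth)
qed

text \<open>Each reflection changes an antidominant vector by a nonnegative multiple of a root, which the rest of
a reduced word keeps positive.\<close>

lemma W_antidominant:
  assumes J: "J \<subseteq> S" and "f \<in> W J" and anti: "\<And>i. i \<in> J \<Longrightarrow> pairing i d \<le> 0"
  shows "nonneg (\<lambda>k. f d k - d k)"
  using assms(2)
proof (induction "len J f" arbitrary: f rule: less_induct)
  case less
  show ?case
  proof (cases "f = id")
    case True
    then show ?thesis by (simp add: nonneg_def)
  next
    case False
    then obtain s where s: "s \<in> J" "\<not> nonneg (f (simple_root s))"
      using no_descent_id[OF less.prems J] by blast
    define g where "g = f \<circ> refl s"
    have g: "g \<in> W J" unfolding g_def using less.prems s W_comp W_refl by blast
    have f: "f = g \<circ> refl s" unfolding g_def using refl_involution[of s] s(1) J by (auto simp: comp_assoc)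
    have len: "len J g + 1 = len J f"
      using len_trichotomy[OF less.prems s(1) J] s unfolding g_def by auto
    then have "nonneg (g (simple_root s))" using len_trichotomy[OF g s(1) J] f by auto
    moreover have "nonneg (\<lambda>k. g d k - d k)" using less.hyps[OF _ g] len by simp
    ultimately have "nonneg (\<lambda>k. (g d k - d k) + (- pairing s d) * g (simple_root s) k)"
      using anti[OF s(1)] by (intro nonneg_add) auto
    moreover have "f d = (\<lambda>k. g d k + (- pairing s d) * g (simple_root s) k)"
      unfolding f comp_apply refl_def using W_linear[OF g, of d "- pairing s d" "simple_root s"] by simp
    ultimately show ?thesis by (simp add: algebra_simps)
  qed
qed

text \<open>A criterion for infinite type. If all simple roots became negative under \<open>f\<close>, then so would the
positive vector \<open>d\<close>, whereas antidominant vectors can only increase.\<close>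

lemma full_descent_empty:
  assumes J: "J \<subseteq> S" and d: "nonneg d" "d \<noteq> (\<lambda>k. 0)" "\<And>k. k \<notin> J \<Longrightarrow> d k = 0"
    and anti: "\<And>i. i \<in> J \<Longrightarrow> pairing i d \<le> 0"
  shows "full_descent J = {}"
proof (rule ccontr)
  assume "full_descent J \<noteq> {}"
  then obtain f where f: "f \<in> W J" "\<And>s. s \<in> J \<Longrightarrow> nonpos (f (simple_root s))"
    by (auto simp: full_descent_def)
  have "nonpos (f d)" using W_nonpos[OF f(1) J f(2) d(1,3)] by simp
  moreover have "nonneg (\<lambda>k. f d k - d k)" by (rule W_antidominant[OF J f(1)]) (rule anti)
  ultimately have "nonpos d" by (simp add: nonneg_def nonpos_def) (meson order_trans)
  then show False using nonneg_nonpos d by blast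
qed

text \<open>The height decides the sign of a root, which is known to be nonnegative or nonpositive in all
coordinates; hence lengths can be followed through integers instead of vectors.\<close>

definition height :: "('i \<Rightarrow> int) \<Rightarrow> int" where
  "height v = (\<Sum>k\<in>S. v k)"

lemma height_root: "j \<in> S \<Longrightarrow> height (simple_root j) = 1"
  by (simp add: height_def simple_root_def finite_S)

lemma height_refl:
  assumes "f \<in> W J" "j \<in> S"
  shows "height ((f \<circ> refl s) (simple_root j)) =
    height (f (simple_root j)) - a s j * height (f (simple_root s))"
  using W_linear[OF assms(1), of "simple_root j" "- a s j" "simple_root s"] assms(2)
  by (simp add: refl_root height_def sum_subtractf sum_distrib_left)

lemma nonpos_height: "nonpos v \<Longrightarrow> height v \<le> 0"
  by (simp add: nonpos_def height_def sum_nonpos)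

lemma nonneg_height: "nonneg v \<Longrightarrow> height v \<ge> 0"
  by (simp add: nonneg_def height_def sum_nonneg)

end

section \<open>Computing Poincare series\<close>

primrec list_fps :: "int list \<Rightarrow> rat fps" where
  "list_fps [] = 0"
| "list_fps (c # cs) = of_int c + fps_X * list_fps cs"

fun padd :: "int list \<Rightarrow> int list \<Rightarrow> int list" where
  "padd (x # xs) (y # ys) = (x + y) # padd xs ys"
| "padd [] ys = ys"
| "padd xs [] = xs"

lemma list_fps_padd: "list_fps (padd p q) = list_fps p + list_fps q"
  by (induction p q rule: padd.induct) (simp_all add: algebra_simps)

lemma list_fps_uminus: "list_fps (map uminus p) = - list_fps p"
  by (induction p) simp_all

lemma list_fps_append: "list_fps (p @ q) = list_fps p + fps_X ^ length p * list_fps q"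
  by (induction p) (simp_all add: algebra_simps)

lemma list_fps_zero: "list_all ((=) 0) p \<Longrightarrow> list_fps p = 0"
  by (induction p) simp_all

text \<open>Equality up to trailing zeros.\<close>

definition coeffs_eq :: "int list \<Rightarrow> int list \<Rightarrow> bool" where
  "coeffs_eq p q \<longleftrightarrow> list_all ((=) 0) (padd p (map uminus q))"

lemma list_fps_coeffs_eq: "coeffs_eq p q \<Longrightarrow> list_fps p = list_fps q"
  using list_fps_zero[of "padd p (map uminus q)"]
  by (simp add: coeffs_eq_def list_fps_padd list_fps_uminus)

lemma list_fps_shift: "list_fps (replicate N 0 @ p) = fps_X ^ N * list_fps p"
  by (simp add: list_fps_append list_fps_zero list_all_iff)

primrec pmul :: "int list \<Rightarrow> int list \<Rightarrow> int list" where
  "pmul [] q = []"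
| "pmul (c # p) q = padd (map ((*) c) q) (0 # pmul p q)"

lemma list_fps_scale: "list_fps (map ((*) c) p) = of_int c * list_fps p"
  by (induction p) (simp_all add: algebra_simps)

lemma list_fps_pmul: "list_fps (pmul p q) = list_fps p * list_fps q"
  by (induction p) (simp_all add: list_fps_padd list_fps_scale algebra_simps)

text \<open>The numbers game of Mozes. The state \<open>x\<close> records the heights of the images of the simple roots under a
group element \<open>f\<close>; firing a positive entry \<open>s\<close> passes from \<open>f\<close> to the longer element \<open>f s\<close>. The game
ends when all entries in \<open>J\<close> are negative, that is, at the longest element of \<open>W J\<close>, and returns
the number of moves. The argument of type \<open>nat\<close> has to exceed
that number.\<close>

primrec numbers_game :: "int list list \<Rightarrow> nat list \<Rightarrow> nat \<Rightarrow> int list \<Rightarrow> nat option" where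
  "numbers_game R J 0 x = None"
| "numbers_game R J (Suc k) x = (case find (\<lambda>s. 0 < x ! s) J of
      None \<Rightarrow> if list_all (\<lambda>j. x ! j < 0) J then Some 0 else None
    | Some s \<Rightarrow> map_option Suc (numbers_game R J k (map2 (\<lambda>c y. y - c * x ! s) (R ! s) x)))"

text \<open>An executable form of the hypotheses of \<open>full_descent_empty\<close>.\<close>

definition antidominant :: "int list list \<Rightarrow> nat list \<Rightarrow> int list \<Rightarrow> bool" where
  "antidominant R J d \<longleftrightarrow> length d = length R \<and> list_all ((\<le>) 0) d \<and> list_ex ((<) 0) d \<and>
    list_all (\<lambda>j. d ! j = 0 \<or> j \<in> set J) [0..<length R] \<and>
    list_all (\<lambda>i. sum_list (map2 (*) (R ! i) d) \<le> 0) J"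

locale simply_laced_rows = simply_laced "{..<length R}" "\<lambda>i j. R ! i ! j" for R :: "int list list" +
  assumes rows: "i < length R \<Longrightarrow> length (R ! i) = length R"
begin

definition heights :: "((nat \<Rightarrow> int) \<Rightarrow> nat \<Rightarrow> int) \<Rightarrow> int list" where
  "heights f = map (\<lambda>j. height (f (simple_root j))) [0..<length R]"

lemma heights_id: "heights id = replicate (length R) 1"
  by (rule nth_equalityI) (simp_all add: heights_def height_root)

lemma heights_refl:
  assumes "f \<in> W J" "s < length R"
  shows "heights (f \<circ> refl s) = map2 (\<lambda>c y. y - c * heights f ! s) (R ! s) (heights f)"
  using assms rows[of s] height_refl[OF assms(1)]
  by (intro nth_equalityI) (simp_all add: heights_def)

lemma numbers_game_sound:
  assumes "set J \<subseteq> {..<length R}" "f \<in> W (set J)" "numbers_game R J k (heights f) = Some N"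
  shows "\<exists>g\<in>full_descent (set J). len (set J) g = len (set J) f + N"
  using assms(2,3)
proof (induction k arbitrary: f N)
  case (Suc k)
  have nth: "heights f ! j = height (f (simple_root j))" if "j \<in> set J" for j
    using that assms(1) by (auto simp: heights_def)
  show ?case
  proof (cases "find (\<lambda>s. 0 < heights f ! s) J")
    case None
    then have neg: "\<forall>j\<in>set J. heights f ! j < 0" and N: "N = 0"
      using Suc.prems(2) by (auto simp: list_all_iff split: if_splits)
    have "nonpos (f (simple_root j))" if "j \<in> set J" for j
      using len_trichotomy[OF Suc.prems(1) that assms(1)] neg that nth[OF that]
        nonneg_height[of "f (simple_root j)"] by auto
    then show ?thesis using Suc.prems(1) N by (auto simp: full_descent_def)
  next
    case (Some s)
    then have s: "s \<in> set J" "0 < heights f ! s" by (auto simp: find_Some_iff)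
    then have s': "s < length R" using assms(1) by auto
    obtain M where M: "numbers_game R J k (heights (f \<circ> refl s)) = Some M" "N = Suc M"
      using Suc.prems Some heights_refl[OF Suc.prems(1) s'] by auto
    obtain g where "g \<in> full_descent (set J)" "len (set J) g = len (set J) (f \<circ> refl s) + M"
      using Suc.IH[OF W_comp[OF Suc.prems(1) W_refl[OF s(1)]] M(1)] by blast
    moreover have "len (set J) (f \<circ> refl s) = len (set J) f + 1"
      using len_trichotomy[OF Suc.prems(1) s(1) assms(1)] s nth[OF s(1)]
        nonpos_height[of "f (simple_root s)"] by auto
    ultimately show ?thesis using M(2) by auto
  qed
qed simp

lemma antidominant_sound:
  assumes J: "set J \<subseteq> {..<length R}" and d: "antidominant R J d"
  shows "full_descent (set J) = {}"
proof (rule full_descent_empty[OF J])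
  define v where "v = (\<lambda>j. if j < length R then d ! j else 0)"
  note D = d[unfolded antidominant_def list_all_iff list_ex_iff]
  show "nonneg v" using D by (auto simp: v_def nonneg_def)
  obtain j where "j < length R" "0 < d ! j" using D by (auto simp: in_set_conv_nth)
  then have "v j \<noteq> 0" by (simp add: v_def)
  then show "v \<noteq> (\<lambda>k. 0)" by blast
  show "v k = 0" if "k \<notin> set J" for k using D that by (auto simp: v_def)
  show "pairing i v \<le> 0" if "i \<in> set J" for i
  proof -
    have "length (R ! i) = length R" using rows that J by auto
    then have "sum_list (map2 (*) (R ! i) d) = pairing i v"
      using D by (simp add: sum_list_sum_nth pairing_def v_def atLeast0LessThan)
    then show ?thesis using D that by auto
  qed
qed

end

lemma filter_mem_subseqs: "filter P xs \<in> set (subseqs xs)"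
  by (induction xs) (auto simp: Let_def)

lemma sum_list_subseqs:
  fixes h :: "'a list \<Rightarrow> 'b :: comm_monoid_add"
  assumes "distinct xs"
  shows "sum_list (map h (subseqs xs)) = (\<Sum>I\<in>Pow (set xs). h (filter (\<lambda>x. x \<in> I) xs))"
  using assms
proof (induction xs arbitrary: h)
  case (Cons x xs)
  let ?f = "\<lambda>I. filter (\<lambda>y. y \<in> I) xs"
  have x: "x \<notin> set xs" using Cons.prems by simp
  have inj: "inj_on (insert x) (Pow (set xs))" using x by (auto simp: inj_on_def)
  have "(\<Sum>I\<in>Pow (set (x # xs)). h (filter (\<lambda>y. y \<in> I) (x # xs))) =
      (\<Sum>I\<in>Pow (set xs). h (filter (\<lambda>y. y \<in> I) (x # xs))) +
      (\<Sum>I\<in>insert x ` Pow (set xs). h (filter (\<lambda>y. y \<in> I) (x # xs)))"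
    unfolding set_simps Pow_insert by (rule sum.union_disjoint) (use x in auto)
  also have "(\<Sum>I\<in>Pow (set xs). h (filter (\<lambda>y. y \<in> I) (x # xs))) = (\<Sum>I\<in>Pow (set xs). h (?f I))"
    using x by (intro sum.cong) auto
  also have "(\<Sum>I\<in>insert x ` Pow (set xs). h (filter (\<lambda>y. y \<in> I) (x # xs))) =
      (\<Sum>I\<in>Pow (set xs). h (x # ?f I))"
    unfolding sum.reindex[OF inj] comp_def
  proof (rule sum.cong[OF refl])
    fix I
    have "filter (\<lambda>y. y = x \<or> y \<in> I) xs = ?f I"
      using x by (intro filter_cong) auto
    then show "h (filter (\<lambda>y. y \<in> insert x I) (x # xs)) = h (x # ?f I)" by simp
  qed
  finally show ?case
    using Cons.IH[of h] Cons.IH[of "\<lambda>I. h (x # I)"] Cons.prems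
    by (simp add: Let_def comp_def add.commute)
qed simp

text \<open>For a list \<open>V\<close> of values at the subsets of \<open>m\<close> elements, in the order of \<open>subseqs\<close> (the subsets that
contain the first element come first), the sums of the values over all subsets of each subset.\<close>

primrec subset_sums :: "nat \<Rightarrow> int list list \<Rightarrow> int list list" where
  "subset_sums 0 V = V"
| "subset_sums (Suc m) V = (let A = subset_sums m (take (2 ^ m) V); B = subset_sums m (drop (2 ^ m) V)
     in map2 padd A B @ B)"

lemma subset_sums_subseqs:
  "map list_fps (subset_sums (length xs) (map h (subseqs xs))) =
    map (\<lambda>J. \<Sum>I\<leftarrow>subseqs J. list_fps (h I)) (subseqs xs)"
proof (induction xs arbitrary: h)
  case (Cons x xs)
  have add: "map list_fps (map2 padd A B) = map2 (+) (map list_fps A) (map list_fps B)" for A B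
    by (rule nth_equalityI) (simp_all add: list_fps_padd)
  define A where "A = subset_sums (length xs) (map (\<lambda>I. h (x # I)) (subseqs xs))"
  define B where "B = subset_sums (length xs) (map h (subseqs xs))"
  let ?t = "\<lambda>J. \<Sum>I\<leftarrow>subseqs J. list_fps (h I)"
  have S: "subset_sums (length (x # xs)) (map h (subseqs (x # xs))) = map2 padd A B @ B"
    by (simp add: Let_def length_subseqs A_def B_def comp_def)
  have B: "map list_fps B = map ?t (subseqs xs)"
    unfolding B_def by (rule Cons.IH)
  have A: "map2 (+) (map list_fps A) (map list_fps B) = map (\<lambda>J. ?t (x # J)) (subseqs xs)"
    unfolding A_def B_def Cons.IH by (rule nth_equalityI) (simp_all add: Let_def comp_def)
  have "map list_fps (map2 padd A B @ B) = map (\<lambda>J. ?t (x # J)) (subseqs xs) @ map ?t (subseqs xs)"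
    unfolding map_append add A unfolding B ..
  also have "\<dots> = map ?t (subseqs (x # xs))" by (simp add: Let_def comp_def)
  finally show ?case by (simp only: S)
qed simp

text \<open>Division of a power series by \<open>1 - t ^ N\<close> or \<open>1 + t ^ N\<close>, according to the flag, truncated to the
length of the list. The buffer holds the last \<open>N\<close> coefficients of the quotient.\<close>

fun geometric :: "bool \<Rightarrow> int list \<Rightarrow> int list \<Rightarrow> int list" where
  "geometric e (h # b) (x # xs) = (let q = (if e then x + h else x - h) in q # geometric e (b @ [q]) xs)"
| "geometric e b xs = []"

text \<open>The largest finite parabolic subgroups that occur have type \<open>D\<^sub>5\<close>, whose longest element has length
20; one more step is needed to recognize the end of the game.\<close>

definition longest :: "int list list \<Rightarrow> nat list \<Rightarrow> nat option" where
  "longest R J = numbers_game R J 21 (replicate (length R) 1)"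

text \<open>Throughout, the value at \<open>J\<close> is meant to be \<open>F\<^sub>J = (-1) ^ card J * D / W\<^sub>J(t)\<close>, where \<open>W\<^sub>J(t)\<close> is the Poincare
series of \<open>W J\<close> and \<open>D\<close> a common multiple of those Poincare series that are polynomials. If \<open>s\<close> is the
sum over the proper subsets of \<open>J\<close>, the recursion reads \<open>s + F\<^sub>J = (-1) ^ card J * t ^ N * F\<^sub>J\<close>, or
\<open>s + F\<^sub>J = 0\<close> when \<open>W J\<close> is infinite.\<close>

definition solve :: "int list list \<Rightarrow> nat list \<Rightarrow> int list \<Rightarrow> int list" where
  "solve R J s = (case longest R J of None \<Rightarrow> map uminus s
     | Some N \<Rightarrow> geometric (even (length J)) (replicate N 0) (map uminus s))"

text \<open>All values \<open>F\<^sub>J\<close> for \<open>K \<subseteq> J \<subseteq> K \<union> set xs\<close>. The list \<open>V\<close> holds, for every \<open>A \<subseteq> set xs\<close>, the sum of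
\<open>F\<^sub>I\<close> over those \<open>I \<subseteq> K \<union> A\<close> that do not contain \<open>K\<close>. The values without \<open>x\<close> come first, since they
enter the sums for the sets that contain \<open>x\<close>. Any table that satisfies the recursion will do,
so only the result is checked, by \<open>certifies\<close> below.\<close>

primrec build :: "int list list \<Rightarrow> int list \<Rightarrow> nat list \<Rightarrow> nat list \<Rightarrow> int list list \<Rightarrow> int list list" where
  "build R D K [] V = [if K = [] then D else solve R K (hd V)]"
| "build R D K (x # xs) V =
    (let B = build R D K xs (drop (2 ^ length xs) V)
     in build R D (K @ [x]) xs (map2 padd (take (2 ^ length xs) V) (subset_sums (length xs) B)) @ B)"

text \<open>The recursion at a nonempty \<open>J\<close>, where \<open>s\<close> is the sum over all subsets of \<open>J\<close> including \<open>J\<close>. For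
infinite \<open>W J\<close> the vector \<open>d\<close> has to witness infinity.\<close>

definition balanced :: "int list list \<Rightarrow> int list \<Rightarrow> nat list \<Rightarrow> int list \<Rightarrow> int list \<Rightarrow> bool" where
  "balanced R d J F s \<longleftrightarrow> (case longest R J of
       None \<Rightarrow> antidominant R J d \<and> coeffs_eq s []
     | Some N \<Rightarrow> 0 < N \<and> coeffs_eq s (replicate N 0 @ (if even (length J) then F else map uminus F)))"

definition certifies :: "int list list \<Rightarrow> int list \<Rightarrow> int list \<Rightarrow> int list list \<Rightarrow> bool" where
  "certifies R D d V \<longleftrightarrow> length V = 2 ^ length R \<and>
    list_all (\<lambda>(J, F, s). if J = [] then coeffs_eq F D else balanced R d J F s)
      (zip (subseqs [0..<length R]) (zip V (subset_sums (length R) V)))"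

context simply_laced_rows
begin

text \<open>By induction on the subset \<open>A\<close>, the tabulated value agrees with the value \<open>p A\<close> obtained from the Poincare
series. Both satisfy the same recursion, so their difference equals \<open>(-1) ^ card A * t ^ N\<close> times itself with
\<open>N > 0\<close>, or is 0 outright.\<close>

theorem certified_series:
  assumes cert: "certifies R D d V"
  shows "list_fps (hd V) =
    (-1) ^ length R * list_fps D * inverse (length_series (W {..<length R}) {..<length R})"
proof -
  let ?S = "{..<length R}" and ?xs = "[0..<length R]"
  define h where "h J = the (map_of (zip (subseqs ?xs) V) J)" for J
  have lenV: "length V = length (subseqs ?xs)"
    using cert by (simp add: certifies_def length_subseqs)
  have "distinct (map set (subseqs ?xs))" by (rule distinct_set_subseqs) simp
  then have dist: "distinct (subseqs ?xs)" by (simp only: distinct_map)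
  have V: "V = map h (subseqs ?xs)"
    using dist lenV by (intro nth_equalityI) (simp_all add: h_def map_of_zip_nth)
  have bal: "if J = [] then list_fps (h J) = list_fps D else
      \<exists>s. list_fps s = (\<Sum>I\<leftarrow>subseqs J. list_fps (h I)) \<and> balanced R d J (h J) s"
    if J: "J \<in> set (subseqs ?xs)" for J
  proof -
    obtain k where k: "k < length (subseqs ?xs)" "J = subseqs ?xs ! k"
      using J by (auto simp: in_set_conv_nth)
    let ?s = "subset_sums (length R) V ! k"
    have sums: "map list_fps (subset_sums (length R) V) = map (\<lambda>J. \<Sum>I\<leftarrow>subseqs J. list_fps (h I)) (subseqs ?xs)"
      using subset_sums_subseqs[of ?xs h] V by simp
    have len: "length (subset_sums (length R) V) = length (subseqs ?xs)"
      using arg_cong[OF sums, of length] by simp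
    have "(J, h J, ?s) \<in> set (zip (subseqs ?xs) (zip V (subset_sums (length R) V)))"
      unfolding in_set_conv_nth using k lenV len V by (intro exI[of _ k]) (simp add: nth_map[of k "subseqs ?xs" h])
    then have "if J = [] then coeffs_eq (h J) D else balanced R d J (h J) ?s"
      using cert unfolding certifies_def list_all_iff by fastforce
    moreover have "list_fps ?s = (\<Sum>I\<leftarrow>subseqs J. list_fps (h I))"
      using arg_cong[OF sums, of "\<lambda>L. L ! k"] k len by simp
    ultimately show ?thesis using list_fps_coeffs_eq by auto
  qed
  define J where "J A = filter (\<lambda>x. x \<in> A) ?xs" for A
  define g where "g A = list_fps (h (J A))" for A
  define p where "p A = (-1) ^ card A * list_fps D * inverse (length_series (W A) A)" for A
  have "finite A \<Longrightarrow> A \<subseteq> ?S \<Longrightarrow> g A = p A" for A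
  proof (induction A rule: finite_psubset_induct)
    case (psubset A)
    have setJ: "set (J A) = A" and distJ: "distinct (J A)" using psubset.prems by (auto simp: J_def)
    have lenJ: "length (J A) = card A" using distinct_card[OF distJ] setJ by simp
    have JI: "filter (\<lambda>x. x \<in> I) (J A) = J I" if "I \<subseteq> A" for I
      using that by (auto simp: J_def intro!: filter_cong)
    have mem: "J A \<in> set (subseqs ?xs)" unfolding J_def by (rule filter_mem_subseqs)
    have sum_g: "(\<Sum>I\<leftarrow>subseqs (J A). list_fps (h I)) = (\<Sum>I\<in>Pow A. g I)"
      unfolding sum_list_subseqs[OF distJ] setJ
      by (rule sum.cong) (simp_all add: g_def JI)
    have sum_p: "(\<Sum>I\<in>Pow A. p I) = list_fps D * length_series (full_descent A) A * inverse (length_series (W A) A)"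
      using inverse_series_recursion[OF psubset.prems]
      by (simp add: p_def mult.assoc mult.left_commute[of _ "list_fps D"] flip: sum_distrib_left)
    have "g I = p I" if "I \<in> Pow A - {A}" for I using that psubset by auto
    then have "(\<Sum>I\<in>Pow A - {A}. g I) = (\<Sum>I\<in>Pow A - {A}. p I)" by (rule sum.cong[OF refl])
    then have diff: "(\<Sum>I\<in>Pow A. g I) - (\<Sum>I\<in>Pow A. p I) = g A - p A"
      using psubset.hyps by (simp add: sum.remove[of "Pow A" A])
    show ?case
    proof (cases "A = {}")
      case True
      then have "J A = []" using setJ by simp
      then have "g A = list_fps D" using bal[OF mem] by (simp add: g_def)
      moreover have "W {} = {id}" by (auto simp: W_def)
      then have "{f \<in> W {}. len {} f = k} = (if k = 0 then {id} else {})" for k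
        using len_id[of "{}"] by auto
      then have "length_series (W {}) {} = 1" by (intro fps_ext) (simp add: length_series_def)
      ultimately show ?thesis using True by (simp add: p_def)
    next
      case False
      then have "J A \<noteq> []" using setJ by auto
      then obtain s where s: "list_fps s = (\<Sum>I\<in>Pow A. g I)" "balanced R d (J A) (h (J A)) s"
        using bal[OF mem] sum_g by auto
      show ?thesis
      proof (cases "longest R (J A)")
        case None
        then have "full_descent A = {}" "coeffs_eq s []"
          using s(2) antidominant_sound[of "J A" d] psubset.prems setJ by (simp_all add: balanced_def)
        then have "(\<Sum>I\<in>Pow A. g I) = 0" "(\<Sum>I\<in>Pow A. p I) = 0"
          using s(1) sum_p list_fps_coeffs_eq[of s "[]"] by (auto simp: length_series_def fps_zero_def[symmetric])
        then show ?thesis using diff by simp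
      next
        case (Some N)
        then have N: "N > 0"
          and c: "coeffs_eq s (replicate N 0 @ (if even (length (J A)) then h (J A) else map uminus (h (J A))))"
          using s(2) by (simp_all add: balanced_def)
        have "(\<Sum>I\<in>Pow A. g I) = (-1) ^ card A * fps_X ^ N * g A"
          using list_fps_coeffs_eq[OF c] s(1)
          by (cases "even (card A)") (simp_all add: list_fps_shift list_fps_uminus g_def lenJ)
        moreover obtain f where f: "f \<in> full_descent A" "len A f = N"
          using numbers_game_sound[of "J A" id _ N] Some W_id psubset.prems setJ heights_id
          by (auto simp: longest_def len_id)
        then have "(\<Sum>I\<in>Pow A. p I) = (-1) ^ card A * fps_X ^ N * p A"
          using sum_p series_full_descent[OF f(1) psubset.prems]
          by (cases "even (card A)") (simp_all add: p_def mult_ac)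
        ultimately have "g A - p A = (-1) ^ card A * fps_X ^ N * (g A - p A)"
          using diff by (simp add: algebra_simps)
        then have "(g A - p A) * (1 - (-1) ^ card A * fps_X ^ N) = 0"
          by (simp add: algebra_simps)
        moreover have "fps_nth (1 - (-1) ^ card A * fps_X ^ N :: rat fps) 0 \<noteq> 0"
          using N by (simp add: fps_mult_nth_0)
        then have "1 - (-1) ^ card A * fps_X ^ N \<noteq> (0 :: rat fps)" by (metis fps_zero_nth)
        ultimately show ?thesis by simp
      qed
    qed
  qed
  from this[of ?S] have "list_fps (h ?xs) = p ?S" by (simp add: g_def J_def)
  moreover have "hd (subseqs xs) = xs" for xs :: "nat list"
  proof (induction xs)
    case (Cons x xs)
    have "subseqs xs \<noteq> []" using length_subseqs[of xs] by auto
    then show ?case using Cons by (simp add: Let_def hd_append hd_map)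
  qed simp
  then have "hd V = h ?xs"
    unfolding V using length_subseqs[of ?xs] by (subst hd_map) auto
  ultimately show ?thesis by (simp add: p_def)
qed

end

section \<open>Weyl groups of simply laced Cartan matrices\<close>

locale weyl_rows = simply_laced_rows R for R :: "int list list" +
  fixes M :: "int mat"
  assumes M_rows: "M = mat_of_rows_list (length R) R"
begin

definition n where "n = length R"

definition word_rel where "word_rel = pres_rel {..<n} (weyl_relators M)"

definition cls :: "nat list \<Rightarrow> nat group_word set" where
  "cls u = word_rel `` {map (\<lambda>i. (i, True)) u}"

lemma dim_M: "dim_row M = n"
  by (simp add: M_rows n_def mat_of_rows_list_def)

lemma M_entry: "i < n \<Longrightarrow> j < n \<Longrightarrow> M $$ (i, j) = R ! i ! j"
  by (simp add: M_rows n_def mat_of_rows_list_def)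

lemma positive_word: "u \<in> lists {..<n} \<Longrightarrow> map (\<lambda>i. (i, True)) u \<in> group_words {..<n}"
  by auto

lemma cls_eq_iff:
  "u \<in> lists {..<n} \<Longrightarrow> v \<in> lists {..<n} \<Longrightarrow>
    cls u = cls v \<longleftrightarrow> (map (\<lambda>i. (i, True)) u, map (\<lambda>i. (i, True)) v) \<in> word_rel"
  unfolding cls_def word_rel_def
  by (rule eq_equiv_class_iff[OF equiv_pres_rel]) (use positive_word in blast)+

lemma exponent:
  assumes "i < n" "j < n" "i \<noteq> j"
  shows "coxeter_exponent M i j = (if R ! i ! j = 0 then 2 else 3)"
  using assms a_off[of i j] a_sym[of i j] by (auto simp: coxeter_exponent_def M_entry n_def)

lemma act_respects:
  assumes "(x, y) \<in> word_rel"
  shows "act (map fst x) = act (map fst y)"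
  using assms unfolding word_rel_def
proof (induction rule: pres_rel.induct)
  case (pres_append u u' v v')
  then show ?case by (simp add: act_append)
next
  case (pres_cancel s b)
  then show ?case using act_square[of s] by (simp add: n_def)
next
  case (pres_relator x)
  then consider (sq) i where "i < n" "x = [(i, True), (i, True)]"
    | (cox) i j m where "i < n" "j < n" "i \<noteq> j" "coxeter_exponent M i j = enat m"
        "x = concat (replicate m [(i, True), (j, True)])"
    unfolding weyl_relators_def dim_M by blast
  then show ?case
  proof cases
    case sq
    then show ?thesis using act_square[of i] by (simp add: n_def)
  next
    case cox
    have ij: "i \<in> {..<length R}" "j \<in> {..<length R}" using cox by (simp_all add: n_def)
    show ?thesis
    proof (cases "R ! i ! j = 0")
      case True
      then have "m = 2" using cox exponent[of i j] by (simp add: numeral_eq_enat)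
      then have "act (map fst x) = act [i, j] \<circ> act [i, j]"
        using cox by (simp add: numeral_eq_Suc act_append[symmetric])
      also have "\<dots> = act [i, j] \<circ> act [j, i]" using act_commute[OF ij True] by simp
      also have "\<dots> = act ([i, j] @ rev [i, j])" by (simp add: act_append[symmetric])
      also have "\<dots> = id" by (rule act_cancel_rev) (use ij in auto)
      finally show ?thesis by simp
    next
      case False
      then have a: "R ! i ! j = -1" using a_off[OF ij] cox by simp
      have "m = 3" using cox exponent[of i j] False by (simp add: numeral_eq_enat)
      then have "act (map fst x) = act [i, j, i] \<circ> act [j, i, j]"
        using cox by (simp add: numeral_eq_Suc act_append[symmetric])
      also have "\<dots> = act [i, j, i] \<circ> act [i, j, i]" using act_braid[OF ij a] by simp
      also have "\<dots> = act ([i, j, i] @ rev [i, j, i])" by (simp add: act_append[symmetric])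
      also have "\<dots> = id" by (rule act_cancel_rev) (use ij in auto)
      finally show ?thesis by simp
    qed
  qed
qed simp_all

lemma cls_cong:
  assumes "cls u = cls v" "u \<in> lists {..<n}" "v \<in> lists {..<n}" "x \<in> lists {..<n}" "y \<in> lists {..<n}"
  shows "cls (x @ u @ y) = cls (x @ v @ y)"
proof -
  have refl: "z \<in> lists {..<n} \<Longrightarrow> (map (\<lambda>i. (i, True)) z, map (\<lambda>i. (i, True)) z) \<in> word_rel" for z
    unfolding word_rel_def by (rule pres_refl[OF positive_word])
  have "(map (\<lambda>i. (i, True)) u, map (\<lambda>i. (i, True)) v) \<in> word_rel" using assms cls_eq_iff by blast
  then have "(map (\<lambda>i. (i, True)) (x @ u @ y), map (\<lambda>i. (i, True)) (x @ v @ y)) \<in> word_rel"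
    using refl[OF assms(4)] refl[OF assms(5)] unfolding map_append word_rel_def by (blast intro: pres_append)
  then show ?thesis using assms by (subst cls_eq_iff) auto
qed

lemma cls_relator:
  assumes "map (\<lambda>i. (i, True)) u \<in> weyl_relators M" "u \<in> lists {..<n}"
  shows "cls u = cls []"
proof -
  have "(map (\<lambda>i. (i, True)) u, []) \<in> word_rel"
    unfolding word_rel_def by (rule pres_relator[OF assms(1) positive_word[OF assms(2)]])
  then show ?thesis using assms(2) by (subst cls_eq_iff) auto
qed

lemma cls_square: "i < n \<Longrightarrow> cls [i, i] = cls []"
  by (rule cls_relator) (auto simp: weyl_relators_def dim_M)

lemma cls_drop_square:
  "x \<in> lists {..<n} \<Longrightarrow> y \<in> lists {..<n} \<Longrightarrow> i < n \<Longrightarrow> cls (x @ i # i # y) = cls (x @ y)"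
  using cls_cong[OF cls_square[of i], of x y] by simp

lemma cls_coxeter:
  assumes "i < n" "j < n" "i \<noteq> j" "coxeter_exponent M i j = enat m"
  shows "cls (concat (replicate m [i, j])) = cls []"
proof (rule cls_relator)
  have "map (\<lambda>i. (i, True)) (concat (replicate m [i, j])) = concat (replicate m [(i, True), (j, True)])"
    by (induction m) simp_all
  then show "map (\<lambda>i. (i, True)) (concat (replicate m [i, j])) \<in> weyl_relators M"
    using assms unfolding weyl_relators_def dim_M by blast
  show "concat (replicate m [i, j]) \<in> lists {..<n}" using assms by (auto split: if_splits)
qed

text \<open>Multiply the relation \<open>(i j)\<^sup>2 = 1\<close> from the right by \<open>j i\<close>.\<close>

lemma cls_commute:
  assumes "i < n" "j < n" "R ! i ! j = 0"
  shows "cls [i, j] = cls [j, i]"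
proof -
  have ij: "i \<noteq> j" using assms a_diag[of i] by (auto simp: n_def)
  have "cls [i, j, i, j] = cls []"
    using cls_coxeter[OF assms(1,2) ij, of 2] exponent[OF assms(1,2) ij] assms(3)
    by (simp add: numeral_eq_enat numeral_eq_Suc)
  then have "cls ([] @ [i, j, i, j] @ [j, i]) = cls ([] @ [] @ [j, i])"
    by (rule cls_cong) (use assms in auto)
  moreover have "cls ([i, j, i] @ j # j # [i]) = cls ([i, j, i] @ [i])"
    by (rule cls_drop_square) (use assms in auto)
  moreover have "cls ([i, j] @ i # i # []) = cls ([i, j] @ [])"
    by (rule cls_drop_square) (use assms in auto)
  ultimately show ?thesis by simp
qed

text \<open>Multiply the relation \<open>(i j)\<^sup>3 = 1\<close> from the right by \<open>j i j\<close>.\<close>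

lemma cls_braid:
  assumes "i < n" "j < n" "R ! i ! j = -1"
  shows "cls [i, j, i] = cls [j, i, j]"
proof -
  have ij: "i \<noteq> j" using assms a_diag[of i] by (auto simp: n_def)
  have "cls [i, j, i, j, i, j] = cls []"
    using cls_coxeter[OF assms(1,2) ij, of 3] exponent[OF assms(1,2) ij] assms(3)
    by (simp add: numeral_eq_enat numeral_eq_Suc)
  then have "cls ([] @ [i, j, i, j, i, j] @ [j, i, j]) = cls ([] @ [] @ [j, i, j])"
    by (rule cls_cong) (use assms in auto)
  moreover have "cls ([i, j, i, j, i] @ j # j # [i, j]) = cls ([i, j, i, j, i] @ [i, j])"
    by (rule cls_drop_square) (use assms in auto)
  moreover have "cls ([i, j, i, j] @ i # i # [j]) = cls ([i, j, i, j] @ [j])"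
    by (rule cls_drop_square) (use assms in auto)
  moreover have "cls ([i, j, i] @ j # j # []) = cls ([i, j, i] @ [])"
    by (rule cls_drop_square) (use assms in auto)
  ultimately show ?thesis by simp
qed

lemma word_group_cls: "word_group {..<length R} (\<lambda>i j. R ! i ! j) {..<length R} cls"
proof unfold_locales
  fix u v assume uv: "cls u = cls v" "u \<in> lists {..<length R}" "v \<in> lists {..<length R}"
  have "(map (\<lambda>i. (i, True)) u, map (\<lambda>i. (i, True)) v) \<in> word_rel"
    using uv cls_eq_iff by (simp add: n_def)
  from act_respects[OF this] show "act u = act v" by (simp add: comp_def)
next
  fix u v x y assume "cls u = cls v" "u \<in> lists {..<length R}" "v \<in> lists {..<length R}"
    "x \<in> lists {..<length R}" "y \<in> lists {..<length R}"
  then show "cls (x @ u @ y) = cls (x @ v @ y)" unfolding n_def[symmetric] by (rule cls_cong)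
next
  fix i assume "i \<in> {..<length R}"
  then show "cls [i, i] = cls []" using cls_square[of i] by (simp add: n_def)
next
  fix i j assume "i \<in> {..<length R}" "j \<in> {..<length R}" "R ! i ! j = 0"
  then show "cls [i, j] = cls [j, i]" using cls_commute[of i j] by (simp add: n_def)
next
  fix i j assume "i \<in> {..<length R}" "j \<in> {..<length R}" "R ! i ! j = -1"
  then show "cls [i, j, i] = cls [j, i, j]" using cls_braid[of i j] by (simp add: n_def)
qed simp

interpretation wg: word_group "{..<length R}" "\<lambda>i j. R ! i ! j" "{..<length R}" cls
  by (rule word_group_cls)

lemma cls_eq_act:
  "u \<in> lists {..<n} \<Longrightarrow> v \<in> lists {..<n} \<Longrightarrow> cls u = cls v \<longleftrightarrow> act u = act v"
  using wg.faithful[of u v] wg.act_eq[of u v] by (auto simp: n_def)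

text \<open>Every formal inverse can be replaced by the generator itself, which is an involution.\<close>

lemma carrier_weyl: "carrier (weyl_group M) = cls ` lists {..<n}"
proof -
  have pos: "(x, map (\<lambda>i. (i, True)) (map fst x)) \<in> word_rel" if "x \<in> group_words {..<n}" for x
    using that
  proof (induction x rule: list.induct)
    case Nil
    then show ?case by (simp add: word_rel_def pres_refl)
  next
    case (Cons l x)
    obtain i b where l: "l = (i, b)" by (cases l)
    have i: "i < n" using Cons.prems l by auto
    have refl: "y \<in> group_words {..<n} \<Longrightarrow> (y, y) \<in> word_rel" for y by (simp add: word_rel_def pres_refl)
    have "([(i, b)], [(i, True)]) \<in> word_rel"
    proof (cases b)
      case True
      then show ?thesis using refl[of "[(i, True)]"] i by simp
    next
      case False
      have sq: "([(i, True), (i, True)], []) \<in> word_rel"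
        unfolding word_rel_def using i by (intro pres_relator) (auto simp: weyl_relators_def dim_M)
      have ca: "([(i, False), (i, True)], []) \<in> word_rel"
        unfolding word_rel_def using pres_cancel[of i "{..<n}" False] i by simp
      have "([(i, False), (i, True)] @ [(i, True)], [] @ [(i, True)]) \<in> word_rel"
        using ca refl[of "[(i, True)]"] i unfolding word_rel_def by (intro pres_append) auto
      moreover have "([(i, False)] @ [(i, True), (i, True)], [(i, False)] @ []) \<in> word_rel"
        using sq refl[of "[(i, False)]"] i unfolding word_rel_def by (intro pres_append) auto
      ultimately show ?thesis using False unfolding word_rel_def
        by (auto intro: pres_trans[OF pres_sym])
    qed
    then have "([(i, b)] @ x, [(i, True)] @ map (\<lambda>i. (i, True)) (map fst x)) \<in> word_rel"
      using Cons unfolding word_rel_def by (intro pres_append) auto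
    then show ?case by (simp add: l)
  qed
  show ?thesis
  proof (intro equalityI subsetI)
    fix X assume "X \<in> carrier (weyl_group M)"
    then have "X \<in> group_words {..<n} // word_rel"
      by (simp add: weyl_group_def presented_group_def dim_M word_rel_def)
    then obtain x where x: "x \<in> group_words {..<n}" "X = word_rel `` {x}" by (rule quotientE)
    have "X = cls (map fst x)"
      unfolding x(2) cls_def using pos[OF x(1)] unfolding word_rel_def
      by (rule equiv_class_eq[OF equiv_pres_rel])
    moreover have "map fst x \<in> lists {..<n}" using x(1) by fastforce
    ultimately show "X \<in> cls ` lists {..<n}" by blast
  next
    fix X assume "X \<in> cls ` lists {..<n}"
    then obtain u where "u \<in> lists {..<n}" "X = cls u" by blast
    then show "X \<in> carrier (weyl_group M)"
      using positive_word[of u]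
      by (simp add: weyl_group_def presented_group_def dim_M word_rel_def cls_def quotientI)
  qed
qed

lemma foldr_gen:
  "u \<in> lists {..<n} \<Longrightarrow>
    foldr (\<lambda>i g. weyl_gen M i \<otimes>\<^bsub>weyl_group M\<^esub> g) u \<one>\<^bsub>weyl_group M\<^esub> = cls u"
proof (induction u rule: list.induct)
  case Nil
  then show ?case by (simp add: weyl_group_def presented_group_def cls_def word_rel_def dim_M)
next
  case (Cons i u)
  then show ?case
    using presented_group_mult[of "[(i, True)]" "{..<n}" "map (\<lambda>i. (i, True)) u" "weyl_relators M"]
      positive_word[of u]
    by (simp add: weyl_group_def weyl_gen_def dim_M cls_def word_rel_def)
qed

lemma weyl_length_cls:
  assumes "u \<in> lists {..<n}"
  shows "weyl_length M (cls u) = len {..<n} (act u)"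
proof -
  have "(\<exists>xs\<in>lists {..<n}. length xs = k \<and>
      cls u = foldr (\<lambda>i g. weyl_gen M i \<otimes>\<^bsub>weyl_group M\<^esub> g) xs \<one>\<^bsub>weyl_group M\<^esub>) \<longleftrightarrow>
    (\<exists>xs\<in>lists {..<n}. length xs = k \<and> act xs = act u)" for k
    using foldr_gen cls_eq_act[OF assms] by (metis (no_types, lifting))
  then show ?thesis unfolding weyl_length_def len_def dim_M by simp
qed

lemma card_image_eq:
  assumes "\<And>x y. x \<in> U \<Longrightarrow> y \<in> U \<Longrightarrow> f x = f y \<longleftrightarrow> g x = g y"
  shows "card (f ` U) = card (g ` U)"
proof -
  have "bij_betw (\<lambda>X. g (inv_into U f X)) (f ` U) (g ` U)"
  proof (rule bij_betw_imageI)
    have *: "g (inv_into U f (f x)) = g x" if "x \<in> U" for x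
      using assms[OF inv_into_into[of "f x" f U] that] f_inv_into_f[of "f x" f U] that by auto
    show "inj_on (\<lambda>X. g (inv_into U f X)) (f ` U)" using * assms by (auto simp: inj_on_def)
    show "(\<lambda>X. g (inv_into U f X)) ` f ` U = g ` U" using * by (force simp: image_image)
  qed
  then show ?thesis by (rule bij_betw_same_card)
qed

text \<open>By faithfulness, two words have the same class if and only if they act equally, and then the lengths agree
as well; so elements of equal length correspond.\<close>

theorem poincare_series_eq: "poincare_series M = length_series (W {..<n}) {..<n}"
proof (rule fps_ext)
  fix k
  define U where "U = {u \<in> lists {..<n}. len {..<n} (act u) = k}"
  have "U = {u \<in> lists {..<n}. weyl_length M (cls u) = k}"
    unfolding U_def by (rule Collect_cong, rule conj_cong, rule refl) (simp only: weyl_length_cls)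
  then have "{X \<in> carrier (weyl_group M). weyl_length M X = k} = cls ` U"
    unfolding carrier_weyl by auto
  moreover have "{f \<in> W {..<n}. len {..<n} f = k} = act ` U"
    unfolding W_def U_def by auto
  moreover have "card (cls ` U) = card (act ` U)"
    by (rule card_image_eq) (simp add: U_def cls_eq_act)
  ultimately show "fps_nth (poincare_series M) k = fps_nth (length_series (W {..<n}) {..<n}) k"
    by (simp add: poincare_series_def length_series_def)
qed

end

section \<open>Indefinite type\<close>

text \<open>In a factorization \<open>M = D S\<close> with \<open>S\<close> symmetric, adjacent indices have equal entries in \<open>D\<close>, because
\<open>M\<close> is symmetric too. The hypothesis \<open>conn\<close>, which says that the graph of \<open>M\<close> is
connected, makes \<open>D\<close> a scalar, which is positive if \<open>S\<close> is positive
semidefinite. Then \<open>w\<close> is a vector on which the form of \<open>S\<close> is negative.\<close>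

lemma indefinite_if_negative_vector:
  fixes M :: "int mat" and w :: "nat \<Rightarrow> int"
  assumes M: "M \<in> carrier_mat n n" and n: "n > 0" and diag: "M $$ (0, 0) = 2"
    and sym: "\<And>i j. i < n \<Longrightarrow> j < n \<Longrightarrow> M $$ (i, j) = M $$ (j, i)"
    and conn: "\<And>(d :: nat \<Rightarrow> real) i. (\<And>i j. i < n \<Longrightarrow> j < n \<Longrightarrow> M $$ (i, j) = -1 \<Longrightarrow> d i = d j) \<Longrightarrow>
      i < n \<Longrightarrow> d i = d 0"
    and neg: "(\<Sum>i<n. \<Sum>j<n. w i * M $$ (i, j) * w j) < 0"
  shows "indefinite_type M"
proof -
  have no_psd: "\<not> pos_semidefinite S" if S: "symmetrization M S" for S
  proof
    assume psd: "pos_semidefinite S"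
    obtain D where SC: "S \<in> carrier_mat n n" and symS: "transpose_mat S = S"
      and D: "D \<in> carrier_mat n n" "diagonal_mat D" "map_mat real_of_int M = D * S"
      using S M by (auto simp: symmetrization_def symmetric_matrix_def)
    define d where "d i = D $$ (i, i)" for i
    have ent: "real_of_int (M $$ (i, j)) = d i * S $$ (i, j)" if "i < n" "j < n" for i j
    proof -
      have "real_of_int (M $$ (i, j)) = (D * S) $$ (i, j)"
        using that M D(3)[symmetric] by simp
      also have "\<dots> = (\<Sum>k\<in>{0..<n}. D $$ (i, k) * S $$ (k, j))"
        using that D(1) SC by (simp add: scalar_prod_def)
      also have "\<dots> = (\<Sum>k\<in>{0..<n}. if k = i then d i * S $$ (i, j) else 0)"
        using that D by (intro sum.cong) (auto simp: diagonal_mat_def d_def)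
      finally show ?thesis using that by simp
    qed
    have S_sym: "S $$ (i, j) = S $$ (j, i)" if "i < n" "j < n" for i j
    proof -
      have "S $$ (i, j) = transpose_mat S $$ (i, j)" using symS by simp
      also have "\<dots> = S $$ (j, i)" using that SC by simp
      finally show ?thesis .
    qed
    have "d i = d j" if "i < n" "j < n" "M $$ (i, j) = -1" for i j
    proof -
      have "M $$ (j, i) = -1" using sym[of i j] that by simp
      then have "d j * S $$ (j, i) = -1" using ent[of j i] that by simp
      moreover have "d i * S $$ (j, i) = -1" using ent[of i j] S_sym[of i j] that by simp
      ultimately have "(d i - d j) * S $$ (j, i) = 0" "S $$ (j, i) \<noteq> 0"
        by (auto simp: left_diff_distrib)
      then show ?thesis by simp
    qed
    then have d: "d i = d 0" if "i < n" for i using conn that by blast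
    have form: "v \<bullet> (S *\<^sub>v v) = (\<Sum>i<n. \<Sum>j<n. v $ i * S $$ (i, j) * v $ j)"
      if "v \<in> carrier_vec n" for v
      using that SC
      by (simp add: scalar_prod_def sum_distrib_left mult.assoc atLeast0LessThan)
    have psd': "(\<Sum>i<n. \<Sum>j<n. f i * S $$ (i, j) * f j) \<ge> 0" for f :: "nat \<Rightarrow> real"
    proof -
      have "vec n f \<bullet> (S *\<^sub>v vec n f) \<ge> 0"
        using psd SC by (simp add: pos_semidefinite_def)
      then show ?thesis by (simp add: form)
    qed
    have "(\<Sum>i<n. \<Sum>j<n. (if i = 0 then 1 else 0) * S $$ (i, j) * (if j = 0 then 1 else 0)) = S $$ (0, 0)"
      using n by (simp add: if_distrib[of "\<lambda>x. x * _"] if_distrib[of "\<lambda>x. _ * x"] cong: if_cong)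
    then have "S $$ (0, 0) \<ge> 0" using psd'[of "\<lambda>i. if i = 0 then 1 else 0"] by simp
    moreover have "d 0 * S $$ (0, 0) = 2" using ent[of 0 0] n diag by simp
    ultimately have pos: "d 0 > 0" by (smt (verit) mult_nonpos_nonneg)
    have scaled: "real_of_int (w i * M $$ (i, j) * w j) =
        d 0 * (real_of_int (w i) * S $$ (i, j) * real_of_int (w j))" if "i < n" "j < n" for i j
      using ent[OF that] d[OF that(1)] by simp
    have "real_of_int (\<Sum>i<n. \<Sum>j<n. w i * M $$ (i, j) * w j) =
        (\<Sum>i<n. \<Sum>j<n. d 0 * (real_of_int (w i) * S $$ (i, j) * real_of_int (w j)))"
      unfolding of_int_sum by (intro sum.cong refl scaled) simp_all
    also have "\<dots> = d 0 * (\<Sum>i<n. \<Sum>j<n. real_of_int (w i) * S $$ (i, j) * real_of_int (w j))"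
      by (simp only: sum_distrib_left)
    also have "\<dots> \<ge> 0" using psd'[of "\<lambda>i. real_of_int (w i)"] pos by simp
    finally show False using neg by linarith
  qed
  have "pos_semidefinite S" if "pos_definite S" for S
    unfolding pos_semidefinite_def
  proof
    fix v :: "real vec" assume v: "v \<in> carrier_vec (dim_row S)"
    show "v \<bullet> (S *\<^sub>v v) \<ge> 0"
    proof (cases "v = 0\<^sub>v (dim_row S)")
      case True
      then show ?thesis by (simp add: scalar_prod_def)
    next
      case False
      then show ?thesis using that v by (simp add: pos_definite_def less_imp_le)
    qed
  qed
  then show ?thesis
    using no_psd by (auto simp: indefinite_type_def finite_type_def affine_type_def)
qed

lemma symmetrizable_if_symmetric:
  assumes "square_mat M" "symmetric_matrix M"
  shows "symmetrizable M"
proof -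
  let ?n = "dim_row M"
  have M: "M \<in> carrier_mat ?n ?n" using assms by auto
  have inv: "invertible_mat (1\<^sub>m ?n :: real mat)"
    by (auto simp: invertible_mat_def inverts_mat_def intro!: exI[of _ "1\<^sub>m ?n"])
  have diag: "diagonal_mat (1\<^sub>m ?n :: real mat)" by (simp add: diagonal_mat_def)
  have "symmetric_matrix (map_mat real_of_int M)"
    using assms(2) unfolding symmetric_matrix_def by (metis map_mat_transpose)
  moreover have C: "map_mat real_of_int M \<in> carrier_mat ?n ?n"
    unfolding map_carrier_mat by (rule M)
  moreover have "map_mat real_of_int M = 1\<^sub>m ?n * map_mat real_of_int M"
    by (rule left_mult_one_mat[OF C, symmetric])
  then have "\<exists>D\<in>carrier_mat ?n ?n. diagonal_mat D \<and> invertible_mat D \<and>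
      map_mat real_of_int M = D * map_mat real_of_int M"
    using inv diag one_carrier_mat by blast
  ultimately have "symmetrization M (map_mat real_of_int M)"
    unfolding symmetrization_def by blast
  then show ?thesis by (auto simp: symmetrizable_def)
qed

section \<open>Poincare series as rational functions and the Kac series\<close>

text \<open>If \<open>ds\<close> lists the degrees of the basic invariants of a finite reflection group, then this is its
Poincare polynomial.\<close>

definition quantum :: "nat list \<Rightarrow> int list" where
  "quantum ds = foldr (\<lambda>d. pmul (replicate d 1)) ds [1]"

lemma list_fps_quantum: "list_fps (quantum ds) = (\<Prod>d\<leftarrow>ds. list_fps (replicate d 1))"
  by (induction ds) (simp_all add: quantum_def list_fps_pmul)

lemma list_fps_ones: "list_fps (replicate d 1) * (1 - fps_X) = 1 - fps_X ^ d"
proof (induction d)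
  case (Suc d)
  have "list_fps (replicate (Suc d) 1) * (1 - fps_X) =
      (1 - fps_X) + fps_X * (list_fps (replicate d 1) * (1 - fps_X))"
    by (simp add: distrib_right mult.assoc)
  then show ?case by (simp only: Suc) (simp add: algebra_simps)
qed simp

lemma quantum_times: "list_fps (quantum ds) * (1 - fps_X) ^ length ds = (\<Prod>d\<leftarrow>ds. 1 - fps_X ^ d)"
proof (induction ds)
  case (Cons d ds)
  have "list_fps (quantum (d # ds)) * (1 - fps_X) ^ length (d # ds) =
      (list_fps (replicate d 1) * (1 - fps_X)) * (list_fps (quantum ds) * (1 - fps_X) ^ length ds)"
    by (simp add: list_fps_quantum mult_ac)
  then show ?case by (simp only: Cons list_fps_ones) simp
qed (simp add: quantum_def)

lemma list_fps_nth: "fps_nth (list_fps p) k = (if k < length p then of_int (p ! k) else 0)"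
  by (induction p arbitrary: k) (auto simp: nth_Cons' fps_X_mult_nth split: nat.splits)

lemma quantum_nonzero: "0 \<notin> set ds \<Longrightarrow> fps_nth (list_fps (quantum ds)) 0 = 1"
  by (induction ds) (auto simp: list_fps_quantum fps_mult_nth_0 list_fps_nth)

definition simply_laced_list :: "int list list \<Rightarrow> bool" where
  "simply_laced_list R \<longleftrightarrow> list_all (\<lambda>r. length r = length R) R \<and>
    list_all (\<lambda>i. R ! i ! i = 2 \<and> list_all (\<lambda>j. R ! i ! j = R ! j ! i \<and>
      (i = j \<or> R ! i ! j = 0 \<or> R ! i ! j = -1)) [0..<length R]) [0..<length R]"

lemma weyl_rowsI:
  assumes "simply_laced_list R"
  shows "weyl_rows R (mat_of_rows_list (length R) R)"
proof -
  have "R ! i ! i = 2 \<and> R ! i ! j = R ! j ! i \<and> (i = j \<or> R ! i ! j = 0 \<or> R ! i ! j = -1)"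
    if "i \<in> {..<length R}" "j \<in> {..<length R}" for i j
    using assms that unfolding simply_laced_list_def list_all_iff set_upt atLeast0LessThan by blast
  moreover have "length (R ! i) = length R" if "i < length R" for i
    using assms that by (simp add: simply_laced_list_def list_all_iff)
  ultimately show ?thesis by unfold_locales blast+
qed

text \<open>The first entry of the table belongs to the set of all generators.\<close>

definition confirms :: "int list list \<Rightarrow> int list \<Rightarrow> int list \<Rightarrow> int list \<Rightarrow> int list list \<Rightarrow> bool" where
  "confirms R D d q V \<longleftrightarrow> certifies R D d V \<and> coeffs_eq (hd V) q"

context weyl_rows
begin

lemma cartan_matrix: "cartan_matrix M"
proof -
  have "M $$ (i, j) \<le> 0" if "i < n" "j < n" "i \<noteq> j" for i j
    using a_off[of i j] that M_entry[of i j] by (auto simp: n_def)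
  moreover have "M $$ (i, i) = 2" if "i < n" for i
    using a_diag[of i] that by (simp add: M_entry n_def)
  moreover have "M $$ (i, j) = M $$ (j, i)" if "i < n" "j < n" for i j
    using a_sym[of i j] that by (simp add: M_entry n_def)
  moreover have "square_mat M" by (simp add: M_rows mat_of_rows_list_def)
  ultimately show ?thesis unfolding cartan_matrix_def dim_M by metis
qed

lemma symmetric_matrix: "symmetric_matrix M"
  unfolding symmetric_matrix_def
proof (rule eq_matI)
  fix i j assume "i < dim_row M" "j < dim_col M"
  then have "i < length R" "j < length R" by (simp_all add: M_rows mat_of_rows_list_def)
  then show "transpose_mat M $$ (i, j) = M $$ (i, j)"
    using a_sym[of i j] by (simp add: M_rows mat_of_rows_list_def)
qed (simp_all add: M_rows mat_of_rows_list_def)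

theorem poincare_confirmed:
  assumes "confirms R (quantum (ds @ cs)) d (pmul q (quantum cs)) V" "even (length R)" "0 \<notin> set cs"
  shows "list_fps q * poincare_series M = list_fps (quantum ds)"
proof -
  let ?P = "poincare_series M"
  have P: "inverse ?P * ?P = 1"
    by (rule inverse_mult_eq_1) (simp add: poincare_series_eq series_W_nth_0)
  have cs: "list_fps (quantum cs) \<noteq> 0"
    using quantum_nonzero[OF assms(3)] by (metis fps_zero_nth zero_neq_one)
  have "list_fps q * list_fps (quantum cs) = list_fps (quantum ds) * list_fps (quantum cs) * inverse ?P"
  proof -
    have cert: "certifies R (quantum (ds @ cs)) d V" and eq: "coeffs_eq (hd V) (pmul q (quantum cs))"
      using assms(1) by (simp_all add: confirms_def)
    have "list_fps q * list_fps (quantum cs) = list_fps (hd V)"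
      by (simp only: list_fps_coeffs_eq[OF eq] list_fps_pmul)
    also have "\<dots> = list_fps (quantum (ds @ cs)) * inverse ?P"
      using certified_series[OF cert] assms(2) by (simp add: poincare_series_eq n_def)
    also have "list_fps (quantum (ds @ cs)) = list_fps (quantum ds) * list_fps (quantum cs)"
      by (simp add: list_fps_quantum)
    finally show ?thesis .
  qed
  then have "(list_fps q * ?P) * list_fps (quantum cs) = list_fps (quantum ds) * list_fps (quantum cs) * (inverse ?P * ?P)"
    by (metis mult.assoc mult.commute)
  then show ?thesis using cs by (simp add: P)
qed

end

text \<open>If \<open>P = m / q\<close>, then \<open>1 / C = q (1 - t\<^sup>2) / (m (1 - t) ^ 6)\<close>. Multiplication of \<open>1 - 1 / C - e\<close> by
the denominator gives the polynomial below; \<open>e\<close> is a correct expansion up to \<open>t ^ k\<close> if its first \<open>k\<close>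
coefficients vanish.\<close>

definition kac_remainder :: "int list \<Rightarrow> int list \<Rightarrow> int list \<Rightarrow> int list" where
  "kac_remainder q m e = padd (pmul (pmul m [1, -6, 15, -20, 15, -6, 1]) (padd [1] (map uminus e)))
      (map uminus (pmul q [1, 0, -1]))"

lemma kac_expansion:
  fixes P :: "rat fps"
  assumes qP: "list_fps q * P = list_fps m" and m: "fps_nth (list_fps m) 0 \<noteq> 0"
    and zero: "list_all ((=) 0) (take k (kac_remainder q m e))" "k \<le> length (kac_remainder q m e)"
  shows "\<exists>F. 1 - inverse (P * (1 - fps_X) ^ 6 * inverse (1 - fps_X ^ 2)) = list_fps e + fps_X ^ k * F"
proof -
  define L where "L = kac_remainder q m e"
  note zero = zero[folded L_def]
  define K where "K = list_fps m * (1 - fps_X) ^ 6"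
  define C where "C = P * (1 - fps_X) ^ 6 * inverse (1 - fps_X ^ 2)"
  have one0: "fps_nth ((1 - fps_X) ^ 6 :: rat fps) 0 = 1" "fps_nth (1 - fps_X ^ 2 :: rat fps) 0 = 1"
    by (simp_all add: fps_power_zeroth)
  have K0: "fps_nth K 0 \<noteq> 0" using m one0 by (simp add: K_def fps_mult_nth_0)
  have "fps_nth P 0 \<noteq> 0" using m unfolding qP[symmetric] by (simp add: fps_mult_nth_0)
  then have C0: "fps_nth C 0 \<noteq> 0" using one0 by (simp add: C_def fps_mult_nth_0)
  have unit: "inverse (1 - fps_X ^ 2) * (1 - fps_X ^ 2 :: rat fps) = 1"
    by (rule inverse_mult_eq_1) (simp add: one0)
  have "C * (list_fps q * (1 - fps_X ^ 2)) = list_fps q * P * (1 - fps_X) ^ 6 * (inverse (1 - fps_X ^ 2) * (1 - fps_X ^ 2))"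
    by (simp only: C_def mult_ac)
  then have CK: "C * (list_fps q * (1 - fps_X ^ 2)) = K" by (simp add: unit qP K_def)
  have "inverse C * K = inverse C * C * (list_fps q * (1 - fps_X ^ 2))"
    by (simp only: CK[symmetric] mult.assoc)
  then have inv: "inverse C * K = list_fps q * (1 - fps_X ^ 2)"
    using inverse_mult_eq_1[OF C0] by simp
  have six: "list_fps [1, -6, 15, -20, 15, -6, 1] = (1 - fps_X) ^ 6"
    by (simp add: algebra_simps numeral_eq_Suc)
  have two: "list_fps [1, 0, -1] = 1 - fps_X ^ 2"
    by (simp add: algebra_simps numeral_eq_Suc)
  have "(1 - inverse C - list_fps e) * K = K * (1 - list_fps e) - inverse C * K"
    by (simp add: algebra_simps)
  also have "\<dots> = list_fps L"
    unfolding L_def kac_remainder_def list_fps_padd list_fps_uminus list_fps_pmul six two inv by (simp add: K_def)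
  also have "\<dots> = list_fps (take k L @ drop k L)" by simp
  also have "\<dots> = fps_X ^ k * list_fps (drop k L)"
    unfolding list_fps_append using zero by (simp add: list_fps_zero)
  finally have "(1 - inverse C - list_fps e) * (K * inverse K) = fps_X ^ k * list_fps (drop k L) * inverse K"
    by (simp only: mult.assoc[symmetric])
  then have "1 - inverse C = list_fps e + fps_X ^ k * (list_fps (drop k L) * inverse K)"
    using inverse_mult_eq_1'[OF K0] by (simp add: algebra_simps)
  then show ?thesis unfolding C_def by blast
qed

lemma not_kac_form:
  assumes "i \<ge> 2" "fps_nth (1 - inverse (kac_series M)) i < 0"
  shows "\<not> has_kac_form M"
proof
  assume "has_kac_form M"
  then obtain b where b: "fps_nth b 0 = 0" "\<forall>i\<ge>2. fps_nth b i \<ge> 0" "kac_series M = 1 / (1 - b)"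
    by (auto simp: has_kac_form_def)
  have u: "fps_nth (1 - b) 0 \<noteq> 0" using b by simp
  then have "kac_series M = inverse (1 - b)" using b(3) by (simp add: fps_divide_unit)
  then have "inverse (kac_series M) = 1 - b" using fps_inverse_idempotent[OF u] by simp
  then show False using assms b(2) by (auto simp: not_less[symmetric])
qed

lemma poincare_quotient:
  assumes "list_fps q * P = list_fps (quantum ds)" "list_fps q \<noteq> 0"
  shows "P = (\<Prod>d\<leftarrow>ds. 1 - fps_X ^ d) / ((1 - fps_X) ^ length ds * list_fps q)"
proof -
  have "fps_nth (1 - fps_X :: rat fps) 0 \<noteq> 0" by simp
  then have "(1 - fps_X :: rat fps) \<noteq> 0" by (metis fps_zero_nth)
  then have "(1 - fps_X) ^ length ds * list_fps q \<noteq> 0" using assms(2) by simp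
  moreover have "(\<Prod>d\<leftarrow>ds. 1 - fps_X ^ d) = P * ((1 - fps_X) ^ length ds * list_fps q)"
    unfolding quantum_times[symmetric] assms(1)[symmetric] by (simp only: mult_ac)
  ultimately show ?thesis by simp
qed

context weyl_rows
begin

lemma indefinite_rows:
  assumes "0 < length R"
    and conn: "\<And>(d :: nat \<Rightarrow> real) i.
      (\<And>i j. i < length R \<Longrightarrow> j < length R \<Longrightarrow> R ! i ! j = -1 \<Longrightarrow> d i = d j) \<Longrightarrow> i < length R \<Longrightarrow> d i = d 0"
    and neg: "(\<Sum>i<length R. \<Sum>j<length R. w i * R ! i ! j * w j) < 0"
  shows "indefinite_type M"
proof (rule indefinite_if_negative_vector[where n = "length R" and w = w])
  show "M \<in> carrier_mat (length R) (length R)"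
    by (simp add: M_rows mat_of_rows_list_def)
  show "M $$ (0, 0) = 2" using assms(1) a_diag[of 0] M_entry[of 0 0] by (simp add: n_def)
  show "M $$ (i, j) = M $$ (j, i)" if "i < length R" "j < length R" for i j
    using that a_sym[of i j] by (simp add: M_entry n_def)
  show "d i = d 0"
    if "\<And>i j. i < length R \<Longrightarrow> j < length R \<Longrightarrow> M $$ (i, j) = -1 \<Longrightarrow> d i = d j" and "i < length R"
    for d :: "nat \<Rightarrow> real" and i
    using conn[of d i] that by (simp add: M_entry n_def)
  have "(\<Sum>i<length R. \<Sum>j<length R. w i * M $$ (i, j) * w j) =
      (\<Sum>i<length R. \<Sum>j<length R. w i * R ! i ! j * w j)"
    by (intro sum.cong refl) (simp add: M_entry n_def)
  then show "(\<Sum>i<length R. \<Sum>j<length R. w i * M $$ (i, j) * w j) < 0" using neg by simp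
qed fact

lemma kac_series_symmetric:
  "kac_series M = poincare_series M * (1 - fps_X) ^ length R * inverse (1 - fps_X ^ 2)"
  using symmetrizable_if_symmetric[OF _ symmetric_matrix] cartan_matrix dim_M
  by (simp add: kac_series_def symm_eps_def cartan_matrix_def n_def)

end

section \<open>The two counterexamples\<close>

text \<open>The graph of \<open>rows_A\<close> is a cycle on the vertices 0 to 4, of affine type, with a pendant vertex 5. That of
\<open>rows_B\<close> is a star with centre 1 and leaves 0, 2, 4, 5, also of affine type, with the vertex 3 attached
to 2.\<close>

definition rows_A :: "int list list" where
  "rows_A =
     [[ 2, -1,  0,  0, -1,  0],
      [-1,  2, -1,  0,  0,  0],
      [ 0, -1,  2, -1,  0,  0],
      [ 0,  0, -1,  2, -1,  0],
      [-1,  0,  0, -1,  2, -1],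
      [ 0,  0,  0,  0, -1,  2]]"

definition rows_B :: "int list list" where
  "rows_B =
     [[ 2, -1,  0,  0,  0,  0],
      [-1,  2, -1,  0, -1, -1],
      [ 0, -1,  2, -1,  0,  0],
      [ 0,  0, -1,  2,  0,  0],
      [ 0, -1,  0,  0,  2,  0],
      [ 0, -1,  0,  0,  0,  2]]"

definition denom_A :: "int list" where
  "denom_A = [1, -2, 0, 1, 0, 0, 0, 1, -1, 1, 0, -1, 0, 0, 0, -1, 1]"

definition denom_B :: "int list" where
  "denom_B = [1, -1, -1, -1, 1, 2, 0, -1, 1, 0, 0, 0, -1, 0, -1, 0, 1]"

definition kac_A :: "int list" where
  "kac_A = [0, 0, 1, 1, 1, 0, 0, 1, 1, 1, 0, 0, 0, 0, 0, -1, -2, -2, -3, -3]"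

definition kac_B :: "int list" where
  "kac_B = [0, 0, 0, 2, 0, 1, -1, 3, -2, 3, -2, 5, -4, 4, -5, 8, -8, 6, -10, 10]"

lemma list_fps_denom_A:
  "list_fps denom_A = fps_X^16 - fps_X^15 - fps_X^11 + fps_X^9 - fps_X^8 + fps_X^7 + fps_X^3 - 2*fps_X + 1"
  by (simp add: denom_A_def algebra_simps numeral_eq_Suc)

lemma list_fps_denom_B:
  "list_fps denom_B = fps_X^16 - fps_X^14 - fps_X^12 + fps_X^8 - fps_X^7 + 2*fps_X^5 + fps_X^4
    - fps_X^3 - fps_X^2 - fps_X + 1"
  by (simp add: denom_B_def algebra_simps numeral_eq_Suc)


lemma list_fps_kac_A:
  "list_fps kac_A = fps_X^2 + fps_X^3 + fps_X^4 + fps_X^7 + fps_X^8 + fps_X^9 - fps_X^15 - 2*fps_X^16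
    - 2*fps_X^17 - 3*fps_X^18 - 3*fps_X^19"
  by (simp add: kac_A_def algebra_simps numeral_eq_Suc)

lemma list_fps_kac_B:
  "list_fps kac_B = 2*fps_X^3 + fps_X^5 - fps_X^6 + 3*fps_X^7 - 2*fps_X^8 + 3*fps_X^9 - 2*fps_X^10
    + 5*fps_X^11 - 4*fps_X^12 + 4*fps_X^13 - 5*fps_X^14 + 8*fps_X^15 - 8*fps_X^16 + 6*fps_X^17
    - 10*fps_X^18 + 10*fps_X^19"
  by (simp add: kac_B_def algebra_simps numeral_eq_Suc)

lemma length_rows: "length rows_A = 6" "length rows_B = 6"
  by (simp_all add: rows_A_def rows_B_def)

lemma cartan_rows:
  "cartan_A = mat_of_rows_list (length rows_A) rows_A"
  "cartan_B = mat_of_rows_list (length rows_B) rows_B"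
  unfolding length_rows unfolding cartan_A_def rows_A_def cartan_B_def rows_B_def by (rule refl)+

lemma weyl_rows_A: "weyl_rows rows_A cartan_A"
  unfolding cartan_rows by (rule weyl_rowsI) code_simp

lemma weyl_rows_B: "weyl_rows rows_B cartan_B"
  unfolding cartan_rows by (rule weyl_rowsI) code_simp

text \<open>The vector is the null root of the affine subgraph; it is antidominant for the whole graph. The
degrees \<open>[2, 5, 6, 8] @ [2, 3, 4]\<close> give a common multiple of the Poincare polynomials of all finite
parabolic subgroups, and \<open>[2, 3, 4]\<close> is the part that cancels in the end. The 64 empty lists are the
initial partial sums, all of them zero.\<close>

lemma confirms_A:
  "confirms rows_A (quantum ([2, 5, 6, 8] @ [2, 3, 4])) [1, 1, 1, 1, 1, 0] (pmul denom_A (quantum [2, 3, 4]))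
     (build rows_A (quantum ([2, 5, 6, 8] @ [2, 3, 4])) [] [0..<6] (replicate 64 []))"
  by code_simp

text \<open>Again the vector is the null root of the affine subgraph, here with coefficient 2 at the centre.\<close>

lemma confirms_B:
  "confirms rows_B (quantum ([2, 2, 4, 6, 8] @ [3, 5])) [1, 2, 1, 0, 1, 1] (pmul denom_B (quantum [3, 5]))
     (build rows_B (quantum ([2, 2, 4, 6, 8] @ [3, 5])) [] [0..<6] (replicate 64 []))"
  by code_simp

lemma poincare_A: "list_fps denom_A * poincare_series cartan_A = list_fps (quantum [2, 5, 6, 8])"
  by (rule weyl_rows.poincare_confirmed[OF weyl_rows_A confirms_A]) (simp_all add: rows_A_def)

lemma poincare_B: "list_fps denom_B * poincare_series cartan_B = list_fps (quantum [2, 2, 4, 6, 8])"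
  by (rule weyl_rows.poincare_confirmed[OF weyl_rows_B confirms_B]) (simp_all add: rows_B_def)

lemma remainder_A:
  "list_all ((=) 0) (take 20 (kac_remainder denom_A (quantum [2, 5, 6, 8]) kac_A)) \<and>
   20 \<le> length (kac_remainder denom_A (quantum [2, 5, 6, 8]) kac_A)"
  by code_simp

lemma remainder_B:
  "list_all ((=) 0) (take 20 (kac_remainder denom_B (quantum [2, 2, 4, 6, 8]) kac_B)) \<and>
   20 \<le> length (kac_remainder denom_B (quantum [2, 2, 4, 6, 8]) kac_B)"
  by code_simp

lemma expansion_A:
  "\<exists>F. 1 - inverse (poincare_series cartan_A * (1 - fps_X) ^ 6 * inverse (1 - fps_X ^ 2)) =
    list_fps kac_A + fps_X ^ 20 * F"
  using remainder_A
  by (intro kac_expansion[OF poincare_A]) (simp_all add: quantum_nonzero)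

lemma expansion_B:
  "\<exists>F. 1 - inverse (poincare_series cartan_B * (1 - fps_X) ^ 6 * inverse (1 - fps_X ^ 2)) =
    list_fps kac_B + fps_X ^ 20 * F"
  using remainder_B
  by (intro kac_expansion[OF poincare_B]) (simp_all add: quantum_nonzero)

text \<open>Twice the null root of the cycle plus the root of the pendant vertex has norm
\<open>0 + 2 * 2 * (-1) + 2 = -2\<close>.\<close>

lemma indefinite_A: "indefinite_type cartan_A"
proof (rule weyl_rows.indefinite_rows[OF weyl_rows_A, where w = "\<lambda>i. [2, 2, 2, 2, 2, 1] ! i"])
  show "d i = d 0"
    if "\<And>i j. i < length rows_A \<Longrightarrow> j < length rows_A \<Longrightarrow> rows_A ! i ! j = -1 \<Longrightarrow> d i = d j"
      and "i < length rows_A"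
    for d :: "nat \<Rightarrow> real" and i
  proof -
    have "d 1 = d 0" "d 2 = d 1" "d 3 = d 2" "d 4 = d 3" "d 5 = d 4"
      by (rule that(1); simp add: rows_A_def)+
    moreover have "i \<in> {0, 1, 2, 3, 4, 5}" using that(2) by (auto simp: length_rows)
    ultimately show ?thesis by auto
  qed
qed (simp_all add: rows_A_def lessThan_nat_numeral lessThan_Suc)

text \<open>Twice the null root of the star plus the root of the vertex 3 has norm \<open>0 + 2 * 2 * (-1) + 2 = -2\<close>.\<close>

lemma indefinite_B: "indefinite_type cartan_B"
proof (rule weyl_rows.indefinite_rows[OF weyl_rows_B, where w = "\<lambda>i. [2, 4, 2, 1, 2, 2] ! i"])
  show "d i = d 0"
    if "\<And>i j. i < length rows_B \<Longrightarrow> j < length rows_B \<Longrightarrow> rows_B ! i ! j = -1 \<Longrightarrow> d i = d j"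
      and "i < length rows_B"
    for d :: "nat \<Rightarrow> real" and i
  proof -
    have "d 1 = d 0" "d 2 = d 1" "d 3 = d 2" "d 4 = d 1" "d 5 = d 1"
      by (rule that(1); simp add: rows_B_def)+
    moreover have "i \<in> {0, 1, 2, 3, 4, 5}" using that(2) by (auto simp: length_rows)
    ultimately show ?thesis by auto
  qed
qed (simp_all add: rows_B_def lessThan_nat_numeral lessThan_Suc)

theorem mainTheorem5:
  fixes C B :: "int mat \<Rightarrow> rat fps" and t :: "rat fps"
  assumes t_def: "t = fps_X"
    and C_def: "\<And>M. M \<in> {cartan_A, cartan_B} \<Longrightarrow>
      C M = poincare_series M * (1 - t) ^ 6 * inverse (1 - t ^ 2)"
    and B_def: "\<And>M. M \<in> {cartan_A, cartan_B} \<Longrightarrow> B M = 1 - inverse (C M)"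
  shows
    "cartan_matrix cartan_A \<and> symmetric_matrix cartan_A \<and>
     cartan_matrix cartan_B \<and> symmetric_matrix cartan_B \<and>
     poincare_series cartan_A =
       ((1 - t^2) * (1 - t^5) * (1 - t^6) * (1 - t^8)) /
       ((1 - t)^4 * (t^16 - t^15 - t^11 + t^9 - t^8 + t^7 + t^3 - 2*t + 1)) \<and>
     poincare_series cartan_B =
       ((1 - t^2)^2 * (1 - t^4) * (1 - t^6) * (1 - t^8)) /
       ((1 - t)^5 * (t^16 - t^14 - t^12 + t^8 - t^7 + 2*t^5 + t^4 - t^3 - t^2 - t + 1)) \<and>
     (\<exists>R. B cartan_A =
       t^2 + t^3 + t^4 + t^7 + t^8 + t^9 - t^15 - 2*t^16 - 2*t^17 - 3*t^18 - 3*t^19 + t^20 * R) \<and>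
     (\<exists>R. B cartan_B =
       2*t^3 + t^5 - t^6 + 3*t^7 - 2*t^8 + 3*t^9 - 2*t^10 + 5*t^11 - 4*t^12 + 4*t^13 - 5*t^14
       + 8*t^15 - 8*t^16 + 6*t^17 - 10*t^18 + 10*t^19 + t^20 * R) \<and>
     (\<exists>i. fps_nth (B cartan_A) i < 0) \<and>
     (\<exists>i. fps_nth (B cartan_B) i < 0) \<and>
     kac_counterexample cartan_A \<and> kac_counterexample cartan_B \<and>
     \<not> kac_conjecture"
proof -
  interpret A: weyl_rows rows_A cartan_A by (rule weyl_rows_A)
  interpret B: weyl_rows rows_B cartan_B by (rule weyl_rows_B)
  have BA: "B cartan_A = 1 - inverse (poincare_series cartan_A * (1 - fps_X) ^ 6 * inverse (1 - fps_X ^ 2))"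
    and BB: "B cartan_B = 1 - inverse (poincare_series cartan_B * (1 - fps_X) ^ 6 * inverse (1 - fps_X ^ 2))"
    by (simp_all add: B_def C_def t_def)
  have kA: "B cartan_A = 1 - inverse (kac_series cartan_A)"
    by (simp only: BA A.kac_series_symmetric length_rows)
  have kB: "B cartan_B = 1 - inverse (kac_series cartan_B)"
    by (simp only: BB B.kac_series_symmetric length_rows)
  obtain FA where FA: "B cartan_A = list_fps kac_A + fps_X ^ 20 * FA" using expansion_A BA by auto
  obtain FB where FB: "B cartan_B = list_fps kac_B + fps_X ^ 20 * FB" using expansion_B BB by auto
  have negA: "fps_nth (B cartan_A) 15 < 0"
    unfolding FA by (simp add: fps_X_power_mult_nth list_fps_nth) (simp add: kac_A_def)
  have negB: "fps_nth (B cartan_B) 6 < 0"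
    unfolding FB by (simp add: fps_X_power_mult_nth list_fps_nth) (simp add: kac_B_def)
  have "fps_nth (list_fps denom_A) 0 \<noteq> 0" "fps_nth (list_fps denom_B) 0 \<noteq> 0"
    by (simp_all add: list_fps_nth denom_A_def denom_B_def)
  then have nz: "list_fps denom_A \<noteq> 0" "list_fps denom_B \<noteq> 0" by (metis fps_zero_nth)+
  have len: "length [2, 5, 6, 8 :: nat] = 4" "length [2, 2, 4, 6, 8 :: nat] = 5" by simp_all
  have PA: "poincare_series cartan_A =
       ((1 - t^2) * (1 - t^5) * (1 - t^6) * (1 - t^8)) /
       ((1 - t)^4 * (t^16 - t^15 - t^11 + t^9 - t^8 + t^7 + t^3 - 2*t + 1))"
    using poincare_quotient[OF poincare_A nz(1), unfolded len] by (simp add: t_def list_fps_denom_A mult.assoc)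
  have PB: "poincare_series cartan_B =
       ((1 - t^2)^2 * (1 - t^4) * (1 - t^6) * (1 - t^8)) /
       ((1 - t)^5 * (t^16 - t^14 - t^12 + t^8 - t^7 + 2*t^5 + t^4 - t^3 - t^2 - t + 1))"
    using poincare_quotient[OF poincare_B nz(2), unfolded len]
    by (simp add: t_def list_fps_denom_B mult.assoc power2_eq_square)
  have EA: "B cartan_A =
       t^2 + t^3 + t^4 + t^7 + t^8 + t^9 - t^15 - 2*t^16 - 2*t^17 - 3*t^18 - 3*t^19 + t^20 * FA"
    unfolding FA t_def list_fps_kac_A ..
  have EB: "B cartan_B =
       2*t^3 + t^5 - t^6 + 3*t^7 - 2*t^8 + 3*t^9 - 2*t^10 + 5*t^11 - 4*t^12 + 4*t^13 - 5*t^14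
       + 8*t^15 - 8*t^16 + 6*t^17 - 10*t^18 + 10*t^19 + t^20 * FB"
    unfolding FB t_def list_fps_kac_B ..
  have "kac_counterexample cartan_A"
    using A.cartan_matrix indefinite_A not_kac_form[of 15 cartan_A] negA kA
    by (simp add: kac_counterexample_def)
  moreover have "kac_counterexample cartan_B"
    using B.cartan_matrix indefinite_B not_kac_form[of 6 cartan_B] negB kB
    by (simp add: kac_counterexample_def)
  ultimately show ?thesis
    using A.cartan_matrix A.symmetric_matrix B.cartan_matrix B.symmetric_matrix PA PB EA EB negA negB
    unfolding kac_conjecture_def kac_counterexample_def by blast
qed

end
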